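(* Let $\mathbb{F}$ be an arbitrary field, let $\mathcal{A}$ be a Hurwitz algebra over $\mathbb{F}$, and let $\mathcal{A}^* = (\mathcal{A},* )$ be a standard composition algebra of type I, II, III or IV obtained from $\mathcal{A}$; if the type is II, III or IV, assume in addition that $\dim \mathcal{A} \ge 2$. Then: (1) If $\mathcal{A}^*$ is of type I, then $l(\mathcal{A}^* ) = \log_2(\dim \mathcal{A}^* )$. (2) If $\mathbb{F} = \mathbb{F}_2$ is the field with two elements, $\mathcal{A} = K(0)$, and $\mathcal{A}^*$ is of type II or III, then $l(\mathcal{A}^* ) = 1$. (3) If $\mathbb{F} = \mathbb{F}_2$, $\mathcal{A} = K(1)$, and $\mathcal{A}^*$ is of type IV, then $l(\mathcal{A}^* ) = 1$. (4) In all other cases, $l(\mathcal{A}^* ) = \max\{2, \log_2(\dim \mathcal{A}^* )\}$.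
   Context: Algebras over $\mathbb{F}$ are vector spaces with a bilinear multiplication, not necessarily unital or associative. A composition algebra is an algebra with a quadratic form $n$ whose polar form $n(a,b)=n(a+b)-n(a)-n(b)$ is a nondegenerate bilinear form and such that $n(ab)=n(a)n(b)$ for all $a,b$. A Hurwitz algebra is a unital composition algebra; with unit $e$, it has the involution $\bar a = n(a,e)e - a$. (Every Hurwitz algebra has dimension $1,2,4$ or $8$.) Given a Hurwitz algebra $\mathcal{A}$, the standard composition algebras $\mathcal{A}^*=(\mathcal{A},* )$ have the underlying vector space $\mathcal{A}$ and product: (I) $a*b=ab$; (II) $a*b=\bar a b$; (III) $a*b = a\bar b$; (IV) $a*b=\bar a\,\bar b$. For $\mu\in\mathbb{F}$ with $4\mu+1\ne 0$, $K(\mu)=\mathbb{F}\oplus\mathbb{F}\ell_1$ is the two-dimensional commutative Hurwitz algebra with unit $1$, $\ell_1^2=\ell_1+\mu$ and involution $\overline{x+y\ell_1}=(x+y)-y\ell_1$ (so $n(x+y\ell_1)=x^2+xy-\mu y^2$). Equalities such as $\mathcal{A}=K(0)$ are understood up to isomorphism. Length: let $\mathcal{B}$ be a finite-dimensional algebra and $S\subseteq\mathcal{B}$. For $k\ge1$, a word of length $k$ in $S$ is any product of $k$ elements of $S$, with any arrangement of brackets; if $\mathcal{B}$ is unital, its unity is the word of length $0$, and if $\mathcal{B}$ is not unital there are no words of length $0$. $\mathcal{L}_k(S)$ is the linear span of all words of length at most $k$ in $S$ (so $\mathcal{L}_0(S)=\{0\}$ if $\mathcal{B}$ is non-unital), and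 $\mathcal{L}_\infty(S)=\bigcup_k\mathcal{L}_k(S)$. $S$ is generating if $\mathcal{L}_\infty(S)=\mathcal{B}$. $l(S)=\min\{k\ge 0:\mathcal{L}_k(S)=\mathcal{L}_\infty(S)\}$, and $l(\mathcal{B})=\max\{l(S): S \text{ generating for } \mathcal{B}\}$. *)

theory Defs
  imports Complex_Main "HOL-Library.Product_Plus" "HOL-Library.Cardinality"
begin

text \<open>
  Algebras over a field live on a whole type \<open>'a\<close>; they need be neither unital nor associative.
\<close>

locale nonassoc_algebra = vector_space scale
  for scale :: "'f::field \<Rightarrow> 'a::ab_group_add \<Rightarrow> 'a" +
  fixes mult :: "'a \<Rightarrow> 'a \<Rightarrow> 'a"
  assumes linear_mult_right: "Vector_Spaces.linear scale scale (\<lambda>b. mult a b)"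
    and linear_mult_left: "Vector_Spaces.linear scale scale (\<lambda>a. mult a b)"

definition is_unity :: "('a \<Rightarrow> 'a \<Rightarrow> 'a) \<Rightarrow> 'a \<Rightarrow> bool" where
  "is_unity mult e \<longleftrightarrow> (\<forall>a. mult e a = a \<and> mult a e = a)"

definition algebra_isomorphic ::
  "('f::field \<Rightarrow> 'a::ab_group_add \<Rightarrow> 'a) \<Rightarrow> ('a \<Rightarrow> 'a \<Rightarrow> 'a) \<Rightarrow>
   ('f \<Rightarrow> 'b::ab_group_add \<Rightarrow> 'b) \<Rightarrow> ('b \<Rightarrow> 'b \<Rightarrow> 'b) \<Rightarrow> bool" where
  "algebra_isomorphic scale1 mult1 scale2 mult2 \<longleftrightarrow>
     (\<exists>f. Vector_Spaces.linear scale1 scale2 f \<and> bij f \<and>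
          (\<forall>a b. f (mult1 a b) = mult2 (f a) (f b)))"


section \<open>Composition algebras and Hurwitz algebras\<close>

definition polar :: "('a::ab_group_add \<Rightarrow> 'f::field) \<Rightarrow> 'a \<Rightarrow> 'a \<Rightarrow> 'f" where
  "polar n a b = n (a + b) - n a - n b"

locale composition_algebra = nonassoc_algebra scale mult
  for scale :: "'f::field \<Rightarrow> 'a::ab_group_add \<Rightarrow> 'a"
    and mult :: "'a \<Rightarrow> 'a \<Rightarrow> 'a" +
  fixes n :: "'a \<Rightarrow> 'f"
  assumes n_scale: "n (scale c a) = c\<^sup>2 * n a"
    and linear_polar_right: "Vector_Spaces.linear scale (*) (\<lambda>b. polar n a b)"
    and linear_polar_left: "Vector_Spaces.linear scale (*) (\<lambda>a. polar n a b)"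
    and polar_nondegenerate: "(\<And>b. polar n a b = 0) \<Longrightarrow> a = 0"
    and n_mult: "n (mult a b) = n a * n b"

text \<open>
  The condition \<open>e \<noteq> 0\<close> only excludes the zero algebra. Finite-dimensionality is not assumed:
  it is a theorem that every Hurwitz algebra has dimension 1, 2, 4 or 8.
\<close>

locale hurwitz_algebra = composition_algebra scale mult n
  for scale :: "'f::field \<Rightarrow> 'a::ab_group_add \<Rightarrow> 'a"
    and mult :: "'a \<Rightarrow> 'a \<Rightarrow> 'a" and n :: "'a \<Rightarrow> 'f" +
  fixes e :: 'a
  assumes unity: "is_unity mult e"
    and unity_nonzero: "e \<noteq> 0"

definition involution ::
  "('f::field \<Rightarrow> 'a::ab_group_add \<Rightarrow> 'a) \<Rightarrow> ('a \<Rightarrow> 'f) \<Rightarrow> 'a \<Rightarrow> 'a \<Rightarrow> 'a" where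
  "involution scale n e a = scale (polar n a e) e - a"

datatype standard_type = TypeI | TypeII | TypeIII | TypeIV

fun standard_mult ::
  "standard_type \<Rightarrow> ('f::field \<Rightarrow> 'a::ab_group_add \<Rightarrow> 'a) \<Rightarrow> ('a \<Rightarrow> 'a \<Rightarrow> 'a) \<Rightarrow>
   ('a \<Rightarrow> 'f) \<Rightarrow> 'a \<Rightarrow> 'a \<Rightarrow> 'a \<Rightarrow> 'a" where
  "standard_mult TypeI scale mult n e a b = mult a b"
| "standard_mult TypeII scale mult n e a b = mult (involution scale n e a) b"
| "standard_mult TypeIII scale mult n e a b = mult a (involution scale n e b)"
| "standard_mult TypeIV scale mult n e a b =
     mult (involution scale n e a) (involution scale n e b)"


section \<open>The two-dimensional algebras \<open>K(\<mu>)\<close>\<close>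

text \<open>
  The pair \<open>(x, y)\<close> stands for \<open>x + y \<ell>\<^sub>1\<close>, where \<open>\<ell>\<^sub>1\<^sup>2 = \<ell>\<^sub>1 + \<mu>\<close>. The requirement
  \<open>4 \<mu> + 1 \<noteq> 0\<close> is not built into the definitions; see \<open>K_hurwitz\<close>.
\<close>

definition K_scale :: "'f::field \<Rightarrow> 'f \<times> 'f \<Rightarrow> 'f \<times> 'f" where
  "K_scale c a = (c * fst a, c * snd a)"

definition K_mult :: "'f::field \<Rightarrow> 'f \<times> 'f \<Rightarrow> 'f \<times> 'f \<Rightarrow> 'f \<times> 'f" where
  "K_mult \<mu> a b =
     (fst a * fst b + \<mu> * (snd a * snd b),
      fst a * snd b + snd a * fst b + snd a * snd b)"

definition K_norm :: "'f::field \<Rightarrow> 'f \<times> 'f \<Rightarrow> 'f" where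
  "K_norm \<mu> a = (fst a)\<^sup>2 + fst a * snd a - \<mu> * (snd a)\<^sup>2"

lemma K_polar:
  "polar (K_norm \<mu>) a b =
     2 * fst a * fst b + fst a * snd b + snd a * fst b - 2 * \<mu> * snd a * snd b"
  by (simp add: polar_def K_norm_def power2_eq_square algebra_simps)

lemma K_vector_space: "vector_space (K_scale :: 'f::field \<Rightarrow> _)"
  by unfold_locales (auto simp: K_scale_def algebra_simps)

lemma K_hurwitz:
  fixes \<mu> :: "'f::field"
  assumes "4 * \<mu> + 1 \<noteq> 0"
  shows "hurwitz_algebra K_scale (K_mult \<mu>) (K_norm \<mu>) (1, 0)"
proof -
  interpret K: vector_space "K_scale :: 'f \<Rightarrow> _" by (rule K_vector_space)
  have nondeg: "a = 0" if "\<And>b. polar (K_norm \<mu>) a b = 0" for a :: "'f \<times> 'f"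
  proof -
    obtain x y where a: "a = (x, y)" by fastforce
    have 1: "2 * x + y = 0" using that[of "(1, 0)"] by (simp add: K_polar a)
    have 2: "x - 2 * \<mu> * y = 0" using that[of "(0, 1)"] by (simp add: K_polar a)
    have "(4 * \<mu> + 1) * y = (2 * x + y) - 2 * (x - 2 * \<mu> * y)" by (simp add: algebra_simps)
    with 1 2 assms have "y = 0" by simp
    with 2 show ?thesis by (simp add: a zero_prod_def)
  qed
  have F: "vector_space ((*) :: 'f \<Rightarrow> _)"
    by unfold_locales (simp_all add: algebra_simps)
  have lin_mult: "Vector_Spaces.linear K_scale K_scale (\<lambda>b. K_mult \<mu> a b)"
    "Vector_Spaces.linear K_scale K_scale (\<lambda>b. K_mult \<mu> b a)" for a
    by (auto simp: Vector_Spaces.linear_iff K_vector_space K_scale_def K_mult_def algebra_simps)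
  have lin_polar: "Vector_Spaces.linear K_scale (*) (\<lambda>b. polar (K_norm \<mu>) a b)"
    "Vector_Spaces.linear K_scale (*) (\<lambda>b. polar (K_norm \<mu>) b a)" for a
    by (auto simp: Vector_Spaces.linear_iff K_vector_space F K_scale_def K_polar algebra_simps)
  show ?thesis
  proof (intro hurwitz_algebra.intro composition_algebra.intro nonassoc_algebra.intro
      hurwitz_algebra_axioms.intro composition_algebra_axioms.intro nonassoc_algebra_axioms.intro)
    show "is_unity (K_mult \<mu>) (1, 0)" by (simp add: is_unity_def K_mult_def)
  next
    show "a = 0" if "\<And>b. polar (K_norm \<mu>) a b = 0" for a :: "'f \<times> 'f"
      using that by (rule nondeg)
  qed (rule K_vector_space lin_mult lin_polar
    | simp add: zero_prod_def K_norm_def K_scale_def K_mult_def power2_eq_square algebra_simps)+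
qed

lemma K_involution: "involution K_scale (K_norm \<mu>) (1, 0) (x, y) = (x + y, - y)"
  by (simp add: involution_def K_polar K_scale_def)


section \<open>Length\<close>

inductive word :: "('a \<Rightarrow> 'a \<Rightarrow> 'a) \<Rightarrow> 'a set \<Rightarrow> nat \<Rightarrow> 'a \<Rightarrow> bool"
  for mult :: "'a \<Rightarrow> 'a \<Rightarrow> 'a" and S :: "'a set" where
  word_unity: "is_unity mult e \<Longrightarrow> word mult S 0 e"
| word_gen: "a \<in> S \<Longrightarrow> word mult S 1 a"
| word_mult: "word mult S i a \<Longrightarrow> word mult S j b \<Longrightarrow> 1 \<le> i \<Longrightarrow> 1 \<le> j \<Longrightarrow>
    word mult S (i + j) (mult a b)"

definition L_upto ::
  "('f::field \<Rightarrow> 'a::ab_group_add \<Rightarrow> 'a) \<Rightarrow> ('a \<Rightarrow> 'a \<Rightarrow> 'a) \<Rightarrow> 'a set \<Rightarrow> nat \<Rightarrow> 'a set" where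
  "L_upto scale mult S k = module.span scale {a. \<exists>i\<le>k. word mult S i a}"

definition L_infty ::
  "('f::field \<Rightarrow> 'a::ab_group_add \<Rightarrow> 'a) \<Rightarrow> ('a \<Rightarrow> 'a \<Rightarrow> 'a) \<Rightarrow> 'a set \<Rightarrow> 'a set" where
  "L_infty scale mult S = (\<Union>k. L_upto scale mult S k)"

definition generating ::
  "('f::field \<Rightarrow> 'a::ab_group_add \<Rightarrow> 'a) \<Rightarrow> ('a \<Rightarrow> 'a \<Rightarrow> 'a) \<Rightarrow> 'a set \<Rightarrow> bool" where
  "generating scale mult S \<longleftrightarrow> L_infty scale mult S = UNIV"

text \<open>
  For a finite-dimensional algebra both the minimum and the maximum below are attained; the set of
  the lengths of generating sets is nonempty, since \<open>UNIV\<close> generates.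
\<close>

definition set_length ::
  "('f::field \<Rightarrow> 'a::ab_group_add \<Rightarrow> 'a) \<Rightarrow> ('a \<Rightarrow> 'a \<Rightarrow> 'a) \<Rightarrow> 'a set \<Rightarrow> nat" where
  "set_length scale mult S = (LEAST k. L_upto scale mult S k = L_infty scale mult S)"

definition alg_length ::
  "('f::field \<Rightarrow> 'a::ab_group_add \<Rightarrow> 'a) \<Rightarrow> ('a \<Rightarrow> 'a \<Rightarrow> 'a) \<Rightarrow> nat" where
  "alg_length scale mult = Max {set_length scale mult S | S. generating scale mult S}"

end

theory Submission
  imports Defs
begin

text \<open>
  In a Hurwitz algebra \<open>x (y z) + y (x z)\<close> and \<open>x y + y x\<close> are sums of shorter products. Hence
  words can be bracketed to the right, and modulo shorter words they are alternating in
  their letters. If a word of length \<open>k\<close> is not a combination of shorter words, its \<open>2 ^ k\<close> subwords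
  are linearly independent, so \<open>dim A = 2 ^ m\<close> gives \<open>L\<^sub>m(S) = A\<close> for every generating \<open>S\<close>. The
  generators \<open>a\<^sub>1, \<dots>, a\<^sub>m\<close> produced by Cayley-Dickson doubling have only \<open>2 ^ m - 1\<close> subwords of
  length less than \<open>m\<close>, so this bound is attained.

  For type II and IV, \<open>L\<^sub>k(S)\<close> is \<open>L\<^sup>*\<^sub>k(S) + F e\<close>, so only \<open>e \<in> L\<^sup>*\<^sub>m(S)\<close> is at stake. If it fails, then
  \<open>S\<close> is orthogonal to \<open>L\<^sup>*\<^bsub>m-1\<^esub>(S)\<close> for the quadratic form \<open>Q\<close> that gives the \<open>e\<close>-component
  of \<open>x * x\<close>, which leaves too little room for \<open>S\<close> to generate \<open>A\<close> when \<open>m \<ge> 2\<close>. When \<open>m = 1\<close>, the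
  length is \<open>2\<close> unless \<open>Q\<close> vanishes outside \<open>F e\<close>, and this happens only over the field with two
  elements. Type III is type II for the opposite algebra.
\<close>

section \<open>Linear algebra\<close>

text \<open>Finite dimension is not given, so Hurwitz's theorem is proved along the way, with
  explicit letters: the same letters later form the slowest generating set. For types II and IV
  \<open>e\<close> is added to them, which supplies the missing unit without enlarging the
  filtration. An irreducible word has independent subwords because every nonzero combination of
  subwords can be driven, by left multiplications, to the full word modulo its proper subwords; a
  linear relation would therefore reduce a word. The room left for \<open>S\<close> is a dimension
  count: if \<open>e\<close> is missing at step m, then \<open>dim (span S)\<close> plus the
  dimension of step m - 1 is at most 2 ^ m. For m = 3 this contradicts the fact that step 2,
  \<open>e\<close> and one word of length 3 span everything. For m = 2 it only says 2 + 2 <= 4,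
  which is no contradiction. There \<open>S\<close> must be shown orthogonal to a product of two
  letters as well, although the products involved have length 3; on isotropic letters such products
  collapse to shorter words.\<close>

context vector_space
begin

text \<open>Each functional cuts the dimension of \<open>W\<close> by at most one. Finiteness is
  asked of \<open>W\<close> only, through \<open>G\<close>, because one use precedes the proof that
  the algebra is finite-dimensional.\<close>

lemma common_zero_exists:
  fixes f :: "'c \<Rightarrow> 'b \<Rightarrow> 'a"
  assumes "finite B" and "\<And>b. b \<in> B \<Longrightarrow> Vector_Spaces.linear scale (*) (f b)"
    and "subspace W" and "W \<subseteq> span G" and "finite G" and "card B < dim W"
  shows "\<exists>w\<in>W. w \<noteq> 0 \<and> (\<forall>b\<in>B. f b w = 0)"
  using assms
proof (induction B arbitrary: W rule: finite_induct)
  case empty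
  obtain C where C: "C \<subseteq> W" "independent C" "card C = dim W"
    by (rule basis_exists)
  with empty have "C \<noteq> {}" by auto
  then obtain c where "c \<in> C" by blast
  with C dependent_zero have "c \<in> W" "c \<noteq> 0" by auto
  then show ?case by auto
next
  case (insert b B)
  show ?case
  proof (cases "\<forall>w\<in>W. f b w = 0")
    case True
    moreover have "\<exists>w\<in>W. w \<noteq> 0 \<and> (\<forall>b\<in>B. f b w = 0)"
    proof (rule insert.IH)
      show "card B < dim W" using insert.prems(5) insert.hyps by simp
    qed (use insert.prems in simp_all)
    ultimately show ?thesis by blast
  next
    case False
    then obtain w0 where w0: "w0 \<in> W" "f b w0 \<noteq> 0" by blast
    interpret fb: Vector_Spaces.linear scale "(*)" "f b"
      using insert.prems(1) by simp
    let ?W = "{w \<in> W. f b w = 0}"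
    have sub: "subspace ?W"
      using insert.prems(2)
      by (simp add: subspace_def fb.add fb.scale)
    obtain C where C: "C \<subseteq> ?W" "independent C" "?W \<subseteq> span C" "card C = dim ?W"
      by (rule basis_exists)
    have finC: "finite C"
      using independent_span_bound[OF insert.prems(4) C(2)] C(1) insert.prems(3) by blast
    have "W \<subseteq> span (insert w0 C)"
    proof
      fix w assume w: "w \<in> W"
      let ?v = "w - scale (f b w / f b w0) w0"
      have "?v \<in> W" using w w0 insert.prems(2) by (simp add: subspace_diff subspace_scale)
      moreover have "f b ?v = 0" using w0 by (simp add: fb.diff fb.scale)
      ultimately have "?v \<in> span C" using C by blast
      then show "w \<in> span (insert w0 C)" by (auto simp: span_insert)
    qed
    then have "dim W \<le> card (insert w0 C)" using finC by (intro dim_le_card) auto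
    also have "\<dots> \<le> Suc (dim ?W)" using finC C(4) by (simp add: card_insert_if)
    finally have "card B < dim ?W" using insert.prems(5) insert.hyps by simp
    then have "\<exists>w\<in>?W. w \<noteq> 0 \<and> (\<forall>b\<in>B. f b w = 0)"
      using insert.prems(1,3) by (intro insert.IH sub insert.prems(4)) auto
    then show ?thesis by blast
  qed
qed

text \<open>Extend a basis \<open>BU\<close> of \<open>U\<close> to a basis \<open>B\<close>. A
  vector of \<open>W\<close> is already orthogonal to \<open>BU\<close>, so the functionals from
  \<open>B - BU\<close> determine it. Nondegeneracy is asked on \<open>W\<close> alone, since the
  form used later can have a radical.\<close>

lemma dim_orthogonal_le:
  fixes \<beta> :: "'b \<Rightarrow> 'b \<Rightarrow> 'a"
  assumes fin: "finite G" "span G = UNIV"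
    and lin1: "\<And>y. Vector_Spaces.linear scale (*) (\<lambda>x. \<beta> x y)"
    and lin2: "\<And>x. Vector_Spaces.linear scale (*) (\<beta> x)"
    and "subspace W" "subspace U"
    and orth: "\<And>w u. w \<in> W \<Longrightarrow> u \<in> U \<Longrightarrow> \<beta> w u = 0"
    and nondeg: "\<And>w. w \<in> W \<Longrightarrow> (\<And>y. \<beta> w y = 0) \<Longrightarrow> w = 0"
  shows "dim W + dim U \<le> dim UNIV"
proof -
  obtain BU where BU: "BU \<subseteq> U" "independent BU" "U \<subseteq> span BU" "card BU = dim U"
    by (rule basis_exists)
  obtain B where B: "BU \<subseteq> B" "independent B" "UNIV \<subseteq> span B"
    using maximal_independent_subset_extend[OF subset_UNIV BU(2)] by auto
  have finB: "finite B" using independent_span_bound[OF fin(1) B(2)] fin(2) by auto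
  have dimB: "dim UNIV = card B" using B by (metis basis_card_eq_dim subset_UNIV)
  have "dim W \<le> card (B - BU)"
  proof (rule ccontr)
    assume "\<not> dim W \<le> card (B - BU)"
    then obtain w where w: "w \<in> W" "w \<noteq> 0" "\<And>b. b \<in> B - BU \<Longrightarrow> \<beta> w b = 0"
      using common_zero_exists[of "B - BU" "\<lambda>b x. \<beta> x b" W G, OF _ lin1 assms(5) _ fin(1)]
        finB fin(2) by auto
    have "\<beta> w b = 0" if "b \<in> B" for b
      using that w orth BU by blast
    then have "B \<subseteq> {y. \<beta> w y = 0}" by blast
    moreover interpret bw: Vector_Spaces.linear scale "(*)" "\<beta> w" by (rule lin2)
    have "subspace {y. \<beta> w y = 0}" by (rule bw.subspace_kernel)
    ultimately have "span B \<subseteq> {y. \<beta> w y = 0}" by (rule span_minimal)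
    then show False using nondeg w B by blast
  qed
  then show ?thesis
    using dimB BU(4) B(1) finB card_mono[OF finB B(1)]
    by (simp add: card_Diff_subset finite_subset)
qed

text \<open>The premise \<open>inj\<close> packs two facts into one: \<open>f\<close> is injective
  on \<open>span B\<close>, and \<open>span B\<close> meets its image trivially. The images of
  \<open>B\<close> can then be added one at a time.\<close>

lemma independent_Un_image:
  assumes "Vector_Spaces.linear scale scale f" and "independent B" and "finite B"
    and inj: "\<And>x y. x \<in> span B \<Longrightarrow> y \<in> span B \<Longrightarrow> x + f y = 0 \<Longrightarrow> y = 0"
  shows "independent (B \<union> f ` B)" and "card (B \<union> f ` B) = 2 * card B"
proof -
  interpret f: Vector_Spaces.linear scale scale f by fact
  have "independent (B \<union> f ` C) \<and> card (B \<union> f ` C) = card B + card C" if "finite C" "C \<subseteq> B" for C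
    using that
  proof (induction C rule: finite_induct)
    case empty
    then show ?case using assms by simp
  next
    case (insert c C)
    have "f c \<notin> span (B \<union> f ` C)"
    proof
      assume "f c \<in> span (B \<union> f ` C)"
      then obtain x y where xy: "f c = x + f y" "x \<in> span B" "y \<in> span C"
        by (auto simp: span_Un f.span_image)
      have "y \<in> span B" using xy(3) span_mono[of C B] insert.prems by auto
      moreover have "c \<in> span B" using insert.prems by (simp add: span_base)
      moreover have "x + f (y - c) = 0" using xy by (simp add: f.diff)
      ultimately have "y = c" using inj[of x "y - c"] xy by (simp add: span_diff)
      then have "c \<in> span (B - {c})"
        using xy(3) insert.hyps insert.prems span_mono[of C "B - {c}"] by auto
      then show False using assms(2) insert.prems by (auto simp: dependent_def)
    qed
    moreover from this have "f c \<notin> B \<union> f ` C" by (meson span_base)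
    ultimately show ?case
      using insert assms(3) by (simp add: independent_insert)
  qed
  from this[OF assms(3) subset_refl]
  show "independent (B \<union> f ` B)" and "card (B \<union> f ` B) = 2 * card B" by auto
qed

end

section \<open>Identities in Hurwitz algebras\<close>

context nonassoc_algebra
begin

lemma mult_add_right: "mult a (b + c) = mult a b + mult a c"
  and mult_scale_right: "mult a (scale r b) = scale r (mult a b)"
  and mult_add_left: "mult (b + c) a = mult b a + mult c a"
  and mult_scale_left: "mult (scale r b) a = scale r (mult b a)"
  using linear_mult_right linear_mult_left by (simp_all add: Vector_Spaces.linear_iff)

lemma mult_zero_right [simp]: "mult a 0 = 0" and mult_zero_left [simp]: "mult 0 a = 0"
  using mult_add_right[of a 0 0] mult_add_left[of 0 0 a] by simp_all

lemma mult_minus_right: "mult a (- b) = - mult a b"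
  and mult_minus_left: "mult (- b) a = - mult b a"
  using mult_add_right[of a b "- b"] mult_add_left[of b "- b" a] by (simp_all add: add_eq_0_iff)

lemma mult_diff_right: "mult a (b - c) = mult a b - mult a c"
  and mult_diff_left: "mult (b - c) a = mult b a - mult c a"
  by (simp_all only: diff_conv_add_uminus mult_add_right mult_add_left mult_minus_right
      mult_minus_left)

lemmas mult_simps = mult_add_right mult_add_left mult_diff_right mult_diff_left
  mult_minus_right mult_minus_left mult_scale_right mult_scale_left

lemma mult_in_subspace:
  assumes "subspace U" and "\<And>x y. x \<in> X \<Longrightarrow> y \<in> Y \<Longrightarrow> mult x y \<in> U"
    and "x \<in> span X" and "y \<in> span Y"
  shows "mult x y \<in> U"
proof -
  have 1: "mult x y \<in> U" if "x \<in> X" for x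
    using assms(4)
  proof (induction rule: span_induct)
    case base
    show ?case using assms(1) by (auto simp: subspace_def mult_simps)
  qed (use assms(2) that in auto)
  show ?thesis using assms(3)
  proof (induction rule: span_induct)
    case base
    show ?case using assms(1) by (auto simp: subspace_def mult_simps)
  qed (use 1 in auto)
qed

lemma mult_left_in_subspace:
  assumes "subspace U" and "\<And>y. y \<in> Y \<Longrightarrow> mult x y \<in> U" and "z \<in> span Y"
  shows "mult x z \<in> U"
  by (rule mult_in_subspace[OF assms(1) _ span_base[OF singletonI] assms(3)]) (use assms(2) in auto)

end

context hurwitz_algebra
begin

abbreviation polar_form :: "'a \<Rightarrow> 'a \<Rightarrow> 'f" where
  "polar_form \<equiv> polar n"

abbreviation trace :: "'a \<Rightarrow> 'f" where
  "trace x \<equiv> polar n x e"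

abbreviation conj :: "'a \<Rightarrow> 'a" where
  "conj \<equiv> involution scale n e"

notation mult (infixl "\<cdot>" 75)
notation scale (infixr "*\<^sub>s" 80)
notation polar_form ("\<langle>_,_\<rangle>")
notation conj ("_\<^bsup>c\<^esup>" [1000] 1000)

lemma unit_left [simp]: "e \<cdot> x = x" and unit_right [simp]: "x \<cdot> e = x"
  using unity by (auto simp: is_unity_def)

lemma polar_commute: "\<langle>x,y\<rangle> = \<langle>y,x\<rangle>"
  by (simp add: polar_def add.commute)

lemma polar_add_right: "\<langle>x,y + z\<rangle> = \<langle>x,y\<rangle> + \<langle>x,z\<rangle>"
  and polar_scale_right: "\<langle>x,c *\<^sub>s y\<rangle> = c * \<langle>x,y\<rangle>"
  using linear_polar_right by (simp_all add: Vector_Spaces.linear_iff)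

lemma polar_add_left: "\<langle>y + z,x\<rangle> = \<langle>y,x\<rangle> + \<langle>z,x\<rangle>"
  and polar_scale_left: "\<langle>c *\<^sub>s y,x\<rangle> = c * \<langle>y,x\<rangle>"
  using linear_polar_left by (simp_all add: Vector_Spaces.linear_iff)

lemma polar_zero [simp]: "\<langle>x,0\<rangle> = 0" "\<langle>0,x\<rangle> = 0"
  using polar_scale_right[of x 0 0] polar_scale_left[of 0 0 x] by simp_all

lemma polar_minus: "\<langle>x,- y\<rangle> = - \<langle>x,y\<rangle>" "\<langle>- y,x\<rangle> = - \<langle>y,x\<rangle>"
  using polar_scale_right[of x "- 1" y] polar_scale_left[of "- 1" y x] by simp_all

lemma polar_diff: "\<langle>x,y - z\<rangle> = \<langle>x,y\<rangle> - \<langle>x,z\<rangle>" "\<langle>y - z,x\<rangle> = \<langle>y,x\<rangle> - \<langle>z,x\<rangle>"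
  by (simp_all only: diff_conv_add_uminus polar_add_right polar_add_left polar_minus)

lemmas polar_simps = polar_add_right polar_add_left polar_scale_right polar_scale_left
  polar_minus polar_diff

lemma polar_eqI: "(\<And>z. \<langle>x,z\<rangle> = \<langle>y,z\<rangle>) \<Longrightarrow> x = y"
  using polar_nondegenerate[of "x - y"] by (simp add: polar_simps)

lemma norm_zero [simp]: "n 0 = 0"
  using n_scale[of 0 0] by simp

lemma norm_minus [simp]: "n (- x) = n x"
  using n_scale[of "- 1" x] by simp

lemma norm_add: "n (x + y) = n x + n y + \<langle>x,y\<rangle>"
  by (simp add: polar_def)

lemma norm_diff: "n (x - y) = n x + n y - \<langle>x,y\<rangle>"
  using norm_add[of x "- y"] by (simp add: polar_minus)

lemma polar_self: "\<langle>x,x\<rangle> = 2 * n x"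
  using n_scale[of 2 x] scale_left_distrib[of 1 1 x] by (simp add: polar_def)

lemma norm_unit [simp]: "n e = 1"
proof -
  obtain x where "n x \<noteq> 0"
    using polar_nondegenerate[of e] unity_nonzero by (metis polar_def diff_self)
  then show ?thesis using n_mult[of e x] by simp
qed

lemma trace_unit: "trace e = 2"
  by (simp add: polar_self)

lemma polar_mult_left: "\<langle>x \<cdot> y,x \<cdot> z\<rangle> = n x * \<langle>y,z\<rangle>"
  and polar_mult_right: "\<langle>y \<cdot> x,z \<cdot> x\<rangle> = \<langle>y,z\<rangle> * n x"
  by (simp_all add: polar_def n_mult algebra_simps flip: mult_add_right mult_add_left)

text \<open>Polarises \<open>polar_mult_left\<close> in the factor \<open>x\<close>. Putting
  \<open>e\<close> for one argument turns it into the two adjoint rules.\<close>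

lemma polar_exchange: "\<langle>x \<cdot> y,z \<cdot> w\<rangle> + \<langle>x \<cdot> w,z \<cdot> y\<rangle> = \<langle>x,z\<rangle> * \<langle>y,w\<rangle>"
  using polar_mult_left[of "x + z" y w] polar_mult_left[of x y w] polar_mult_left[of z y w]
  by (simp add: mult_simps polar_simps norm_add algebra_simps polar_commute)

lemma conj_eq: "x\<^bsup>c\<^esup> = trace x *\<^sub>s e - x"
  by (simp add: involution_def)

lemma trace_conj [simp]: "trace (x\<^bsup>c\<^esup>) = trace x"
  by (simp add: conj_eq polar_simps trace_unit)

lemma conj_conj [simp]: "x\<^bsup>c\<^esup>\<^bsup>c\<^esup> = x"
  using trace_conj[of x] by (simp add: conj_eq[of "x\<^bsup>c\<^esup>"]) (simp add: conj_eq)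

lemma conj_unit [simp]: "e\<^bsup>c\<^esup> = e"
  using scale_left_distrib[of 1 1 e] by (simp add: conj_eq trace_unit)

lemma conj_add: "(x + y)\<^bsup>c\<^esup> = x\<^bsup>c\<^esup> + y\<^bsup>c\<^esup>"
  and conj_scale: "(r *\<^sub>s x)\<^bsup>c\<^esup> = r *\<^sub>s x\<^bsup>c\<^esup>"
  by (simp_all add: conj_eq polar_simps algebra_simps)

lemma norm_conj [simp]: "n (x\<^bsup>c\<^esup>) = n x"
  by (simp add: conj_eq norm_diff n_scale polar_simps polar_commute power2_eq_square)

lemma polar_conj: "\<langle>x\<^bsup>c\<^esup>,y\<^bsup>c\<^esup>\<rangle> = \<langle>x,y\<rangle>"
  by (simp add: polar_def flip: conj_add)

lemma polar_adjoint_left: "\<langle>x \<cdot> y,z\<rangle> = \<langle>y,x\<^bsup>c\<^esup> \<cdot> z\<rangle>"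
  using polar_exchange[of x y e z]
  by (simp add: conj_eq mult_simps polar_simps polar_commute algebra_simps)

lemma polar_adjoint_right: "\<langle>x \<cdot> y,z\<rangle> = \<langle>x,z \<cdot> y\<^bsup>c\<^esup>\<rangle>"
  using polar_exchange[of x y z e]
  by (simp add: conj_eq mult_simps polar_simps polar_commute algebra_simps)

lemma conj_mult: "(x \<cdot> y)\<^bsup>c\<^esup> = y\<^bsup>c\<^esup> \<cdot> x\<^bsup>c\<^esup>"
proof (rule polar_eqI)
  fix z
  have "\<langle>(x \<cdot> y)\<^bsup>c\<^esup>,z\<rangle> = \<langle>x \<cdot> y,z\<^bsup>c\<^esup>\<rangle>" by (metis conj_conj polar_conj)
  also have "\<dots> = \<langle>y,x\<^bsup>c\<^esup> \<cdot> z\<^bsup>c\<^esup>\<rangle>" by (rule polar_adjoint_left)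
  also have "\<dots> = \<langle>y \<cdot> z,x\<^bsup>c\<^esup>\<rangle>" by (metis conj_conj polar_adjoint_right)
  also have "\<dots> = \<langle>y\<^bsup>c\<^esup> \<cdot> x\<^bsup>c\<^esup>,z\<rangle>"
    by (metis conj_conj polar_adjoint_left polar_commute)
  finally show "\<langle>(x \<cdot> y)\<^bsup>c\<^esup>,z\<rangle> = \<langle>y\<^bsup>c\<^esup> \<cdot> x\<^bsup>c\<^esup>,z\<rangle>" .
qed

lemma conj_mult_cancel_left: "x\<^bsup>c\<^esup> \<cdot> (x \<cdot> y) = n x *\<^sub>s y"
proof (rule polar_eqI)
  show "\<langle>x\<^bsup>c\<^esup> \<cdot> (x \<cdot> y),z\<rangle> = \<langle>n x *\<^sub>s y,z\<rangle>" for z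
    using polar_adjoint_left[of "x\<^bsup>c\<^esup>" "x \<cdot> y" z] polar_mult_left[of x y z]
    by (simp add: polar_simps)
qed

lemma conj_mult_cancel_right: "(y \<cdot> x) \<cdot> x\<^bsup>c\<^esup> = n x *\<^sub>s y"
  using conj_mult_cancel_left[of "x\<^bsup>c\<^esup>" "y\<^bsup>c\<^esup>"] conj_conj
  by (metis conj_mult conj_scale norm_conj)

lemma mult_conj_self: "x\<^bsup>c\<^esup> \<cdot> x = n x *\<^sub>s e"
  using conj_mult_cancel_left[of x e] by simp

lemma square: "x \<cdot> x = trace x *\<^sub>s x - n x *\<^sub>s e"
  using mult_conj_self[of x] by (simp add: conj_eq mult_simps algebra_simps)

lemma anticommutator: "y \<cdot> x = trace x *\<^sub>s y + trace y *\<^sub>s x - \<langle>x,y\<rangle> *\<^sub>s e - x \<cdot> y"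
  using square[of "x + y"] square[of x] square[of y]
  by (simp add: mult_simps polar_simps norm_add algebra_simps)

lemma left_square: "x \<cdot> (x \<cdot> y) = trace x *\<^sub>s (x \<cdot> y) - n x *\<^sub>s y"
  using conj_mult_cancel_left[of x y] by (simp add: conj_eq mult_simps algebra_simps)

lemma right_square: "(y \<cdot> x) \<cdot> x = trace x *\<^sub>s (y \<cdot> x) - n x *\<^sub>s y"
  using conj_mult_cancel_right[of y x] by (simp add: conj_eq mult_simps algebra_simps)

text \<open>Linearises \<open>left_square\<close>. This is the rewriting rule behind all reordering
  of words: two adjacent left factors anticommute up to shorter products.\<close>

lemma left_exchange:
  "x \<cdot> (y \<cdot> z) = trace x *\<^sub>s (y \<cdot> z) + trace y *\<^sub>s (x \<cdot> z) - \<langle>x,y\<rangle> *\<^sub>s z - y \<cdot> (x \<cdot> z)"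
proof -
  have "x \<cdot> (x \<cdot> z) + y \<cdot> (x \<cdot> z) + (x \<cdot> (y \<cdot> z) + y \<cdot> (y \<cdot> z)) =
      (trace x + trace y) *\<^sub>s (x \<cdot> z + y \<cdot> z) - (n x + n y + \<langle>x,y\<rangle>) *\<^sub>s z"
    using left_square[of "x + y" z]
    by (simp only: mult_add_left mult_add_right polar_add_left norm_add)
  then show ?thesis
    unfolding left_square by (simp add: algebra_simps)
qed

section \<open>Products of subwords\<close>

text \<open>Right-nested products of the subsequences with at most \<open>k\<close> letters. These
  are values and not formal words: different subsequences may give the same element, so independence
  will always be stated together with the cardinality.\<close>

fun subwords :: "nat \<Rightarrow> 'a list \<Rightarrow> 'a set" where
  "subwords 0 as = {e}"
| "subwords (Suc k) [] = {e}"
| "subwords (Suc k) (a # as) = subwords (Suc k) as \<union> (\<cdot>) a ` subwords k as"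

lemma subwords_Nil [simp]: "subwords k [] = {e}"
  by (cases k) auto

lemma finite_subwords [simp]: "finite (subwords k as)"
  by (induction k as rule: subwords.induct) auto

lemma unit_in_subwords [simp]: "e \<in> subwords k as"
  by (induction k as rule: subwords.induct) auto

lemma subwords_Suc: "subwords k as \<subseteq> subwords (Suc k) as"
  by (induction k as rule: subwords.induct) auto

lemma subwords_Cons: "subwords k as \<subseteq> subwords k (a # as)"
  by (cases k) auto

lemma subwords_saturated: "length as \<le> k \<Longrightarrow> subwords k as = subwords (length as) as"
proof -
  have *: "length as \<le> k \<Longrightarrow> subwords (Suc k) as = subwords k as" for k
    by (induction k as rule: subwords.induct) auto
  show "length as \<le> k \<Longrightarrow> ?thesis"
    by (induction k rule: dec_induct) (simp_all only: *)
qed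

lemma card_subwords_le: "card (subwords k as) \<le> (\<Sum>i\<le>k. length as choose i)"
proof (induction k as rule: subwords.induct)
  case (2 k)
  then show ?case by (simp add: sum.atMost_Suc_shift del: sum.atMost_Suc)
next
  case (3 k a as)
  have "card (subwords (Suc k) (a # as)) \<le> card (subwords (Suc k) as) + card ((\<cdot>) a ` subwords k as)"
    by (simp add: card_Un_le)
  also have "card ((\<cdot>) a ` subwords k as) \<le> card (subwords k as)"
    by (simp add: card_image_le)
  also have "card (subwords (Suc k) as) \<le> 1 + (\<Sum>i\<le>k. length as choose Suc i)"
    using "3.IH"(1) by (simp add: sum.atMost_Suc_shift del: sum.atMost_Suc)
  also have "card (subwords k as) \<le> (\<Sum>i\<le>k. length as choose i)"
    by (rule "3.IH"(2))
  also have "1 + (\<Sum>i\<le>k. length as choose Suc i) + (\<Sum>i\<le>k. length as choose i) =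
      (\<Sum>i\<le>Suc k. length (a # as) choose i)"
    by (simp add: sum.atMost_Suc_shift sum.distrib del: sum.atMost_Suc)
  finally show ?case by simp
qed simp

lemma mult_Cons_in_span:
  "z \<in> span (subwords k as) \<Longrightarrow> a \<cdot> z \<in> span (subwords (Suc k) (a # as))"
  by (erule mult_left_in_subspace[OF subspace_span, rotated]) (auto intro: span_base)

text \<open>The letter \<open>x\<close> travels inwards to its place in the list:
  \<open>left_exchange\<close> moves it past the head \<open>a\<close>, and
  \<open>left_square\<close> absorbs it when it equals \<open>a\<close>. All by-products have at
  most as many letters.\<close>

lemma mult_letter_in_span:
  "x \<in> set as \<Longrightarrow> z \<in> span (subwords k as) \<Longrightarrow> x \<cdot> z \<in> span (subwords (Suc k) as)"
proof (induction as arbitrary: k z)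
  case (Cons a as)
  have up: "y \<in> span (subwords j as) \<Longrightarrow> y \<in> span (subwords j (a # as))" for j y
    using span_mono[OF subwords_Cons] by blast
  have "x \<cdot> z \<in> span (subwords (Suc k) (a # as))" if z: "z \<in> subwords k (a # as)" for z
  proof (cases "z \<in> subwords k as")
    case True
    then show ?thesis
    proof (cases "x = a")
      case False
      then show ?thesis using Cons True by (auto intro: up span_base simp del: subwords.simps)
    qed (auto intro: span_base)
  next
    case False
    with z obtain j z' where k: "k = Suc j" and z': "z = a \<cdot> z'" "z' \<in> subwords j as"
      by (cases k) auto
    have 1: "a \<cdot> z' \<in> span (subwords (Suc k) (a # as))"
      using z' k subwords_Suc by (auto intro!: span_base)
    have 2: "z' \<in> span (subwords (Suc k) (a # as))"
      using z' k subwords_Suc subwords_Cons by (blast intro: span_base)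
    show ?thesis
    proof (cases "x = a")
      case True
      then show ?thesis using 1 2 by (simp only: z' left_square span_diff span_scale)
    next
      case False
      then have 3: "x \<cdot> z' \<in> span (subwords k as)"
        using Cons.IH[of z' j] Cons.prems(1) z' k by (simp add: span_base)
      then have 4: "x \<cdot> z' \<in> span (subwords (Suc k) (a # as))"
        using span_mono[OF subwords_Suc] up by blast
      show ?thesis
        using 1 2 4 mult_Cons_in_span[OF 3, of a]
        unfolding z' left_exchange[of x] by (intro span_diff span_add span_scale)
    qed
  qed
  then show ?case
    using Cons.prems(2) by (rule mult_left_in_subspace[OF subspace_span])
qed simp

lemma mult_in_span_subwords:
  assumes "x \<in> span (insert e (set as))" and "z \<in> span (subwords k as)"
  shows "x \<cdot> z \<in> span (subwords (Suc k) as)"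
proof (rule mult_in_subspace[OF _ _ assms])
  fix x y assume x: "x \<in> insert e (set as)" and y: "y \<in> subwords k as"
  have "y \<in> span (subwords (Suc k) as)" using y subwords_Suc by (blast intro: span_base)
  then show "x \<cdot> y \<in> span (subwords (Suc k) as)"
    using mult_letter_in_span[of x as y k] x y by (auto intro: span_base simp del: subwords.simps)
qed simp

text \<open>This turns out to be the unital subalgebra generated by \<open>as\<close>, see
  \<open>gen_closed\<close>; written this way it shows a spanning set of at most
  \<open>2 ^ length as\<close> elements.\<close>

abbreviation gen :: "'a list \<Rightarrow> 'a set" where
  "gen as \<equiv> span (subwords (length as) as)"

lemma subwords_full_Cons:
  "subwords (length (a # as)) (a # as) =
     subwords (length as) as \<union> (\<cdot>) a ` subwords (length as) as"
  using subwords_saturated[of as "Suc (length as)"] by simp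

lemma mult_in_gen:
  "x \<in> span (insert e (set as)) \<Longrightarrow> z \<in> gen as \<Longrightarrow> x \<cdot> z \<in> gen as"
  using mult_in_span_subwords[of x as z "length as"] subwords_saturated[of as "Suc (length as)"]
  by simp

lemma linear_mult: "Vector_Spaces.linear scale scale ((\<cdot>) a)"
  using linear_mult_right[of a] by simp

lemma gen_Cons: "gen (a # as) = {x + a \<cdot> y | x y. x \<in> gen as \<and> y \<in> gen as}"
proof -
  interpret f: Vector_Spaces.linear scale scale "(\<cdot>) a" by (rule linear_mult)
  show ?thesis unfolding subwords_full_Cons span_Un f.span_image by blast
qed

section \<open>The length filtration\<close>

text \<open>Only left multiplication by letters occurs here, so a priori only right-bracketed words
  are covered; \<open>mult_in_filt\<close> shows that no bracketing escapes.\<close>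

fun filt :: "'a set \<Rightarrow> nat \<Rightarrow> 'a set" where
  "filt S 0 = span {e}"
| "filt S (Suc k) = span (filt S k \<union> {a \<cdot> x | a x. a \<in> S \<and> x \<in> filt S k})"

lemma subspace_filt [simp]: "subspace (filt S k)"
  by (cases k) auto

lemma filt_Suc: "filt S k \<subseteq> filt S (Suc k)"
  by (auto intro: span_base)

lemma filt_mono: "i \<le> j \<Longrightarrow> filt S i \<subseteq> filt S j"
  by (rule lift_Suc_mono_le[of "filt S"]) (rule filt_Suc)

lemma unit_in_filt [simp]: "e \<in> filt S k"
  using filt_mono[of 0 k S] by (auto intro: span_base)

lemma mult_letter_in_filt:
  assumes "x \<in> span (insert e S)" and "z \<in> filt S k"
  shows "x \<cdot> z \<in> filt S (Suc k)"
proof (rule mult_in_subspace[OF subspace_filt _ assms(1) span_base[OF assms(2)]])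
  fix x y assume "x \<in> insert e S" "y \<in> filt S k"
  then show "x \<cdot> y \<in> filt S (Suc k)"
    using filt_Suc[of S k] by (auto intro: span_base)
qed

lemma span_letters_subset_filt: "span (insert e S) \<subseteq> filt S (Suc 0)"
  using mult_letter_in_filt[of _ S e 0] unit_in_filt[of S 0] by (metis subsetI unit_right)

text \<open>Induction on the length of the right factor: \<open>left_exchange\<close> rewrites
  \<open>x \<cdot> (a \<cdot> y)\<close> with the letter \<open>a\<close> outermost, leaving the
  product \<open>x \<cdot> y\<close> with a shorter right factor.\<close>

lemma mult_in_filt: "x \<in> filt S i \<Longrightarrow> z \<in> filt S j \<Longrightarrow> x \<cdot> z \<in> filt S (i + j)"
proof (induction j arbitrary: x z)
  case 0
  then obtain r where "z = r *\<^sub>s e" by (auto simp: span_singleton)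
  then show ?case using 0 by (simp add: mult_simps subspace_scale)
next
  case (Suc j)
  let ?F = "filt S (i + Suc j)"
  have gens: "x \<cdot> z \<in> ?F" if z: "z \<in> filt S j \<union> {a \<cdot> x | a x. a \<in> S \<and> x \<in> filt S j}" for z
  proof (cases "z \<in> filt S j")
    case True
    then show ?thesis using Suc.IH Suc.prems(1) filt_mono[of "i + j" "i + Suc j"] by auto
  next
    case False
    with z obtain a y where z: "z = a \<cdot> y" and a: "a \<in> S" and y: "y \<in> filt S j" by blast
    have aV: "a \<in> span (insert e S)" using a by (simp add: span_base)
    have xy: "x \<cdot> y \<in> filt S (i + j)" using Suc.IH Suc.prems(1) y by blast
    then have "x \<cdot> y \<in> ?F" using filt_mono[of "i + j" "i + Suc j"] by auto
    moreover have "a \<cdot> (x \<cdot> y) \<in> ?F" using mult_letter_in_filt[OF aV xy] by simp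
    moreover have "a \<cdot> y \<in> ?F"
      using mult_letter_in_filt[OF aV y] filt_mono[of "Suc j" "i + Suc j"] by auto
    moreover have "y \<in> ?F" using y filt_mono[of j "i + Suc j"] by auto
    ultimately show ?thesis
      unfolding z left_exchange[of x] by (intro subspace_diff subspace_add subspace_scale) simp_all
  qed
  have "z \<in> span (filt S j \<union> {a \<cdot> x | a x. a \<in> S \<and> x \<in> filt S j})"
    using Suc.prems(2) by simp
  from mult_left_in_subspace[OF subspace_filt _ this] show ?case using gens by blast
qed

lemma conj_in_filt: "x \<in> filt S k \<Longrightarrow> x\<^bsup>c\<^esup> \<in> filt S k"
  unfolding conj_eq by (intro subspace_diff subspace_scale) simp_all

text \<open>Since \<open>S\<close> enters only through its span together with \<open>e\<close>, an
  infinite \<open>S\<close> can be traded for a finite list of letters, and dimensions can be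
  counted by subwords.\<close>

lemma filt_subset_span_subwords:
  assumes "S \<subseteq> span (insert e (set as))"
  shows "filt S k \<subseteq> span (subwords k as)"
proof (induction k)
  case (Suc k)
  show ?case unfolding filt.simps
  proof (rule span_minimal)
    show "filt S k \<union> {a \<cdot> x |a x. a \<in> S \<and> x \<in> filt S k} \<subseteq> span (subwords (Suc k) as)"
      using Suc span_mono[OF subwords_Suc[of k as]] mult_in_span_subwords assms by blast
  qed simp
qed simp

lemma span_subwords_subset_filt:
  assumes "set as \<subseteq> span (insert e S)"
  shows "span (subwords k as) \<subseteq> filt S k"
proof (rule span_minimal)
  show "subwords k as \<subseteq> filt S k" using assms
  proof (induction k as rule: subwords.induct)
    case (3 k a as)
    then show ?case using mult_letter_in_filt[of a S _ k] by auto
  qed (simp_all add: span_base)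
qed simp

lemma filt_eq_span_subwords: "filt (set as) k = span (subwords k as)"
  using filt_subset_span_subwords[of "set as" as k] span_subwords_subset_filt[of as "set as" k]
    span_superset[of "insert e (set as)"] by blast

lemma filt_stable: "filt S (Suc k) = filt S k \<Longrightarrow> k \<le> j \<Longrightarrow> filt S j = filt S k"
  by (rotate_tac, induction j rule: dec_induct) auto

lemma filt_eq_span_products:
  "filt S k = span {foldr (\<cdot>) as e | as. set as \<subseteq> S \<and> length as \<le> k}" (is "_ = span (?P k)")
proof (induction k)
  case 0
  have "?P 0 = {e}" by auto
  then show ?case by simp
next
  case (Suc k)
  have "filt S (Suc k) \<subseteq> span (?P (Suc k))"
    unfolding filt.simps
  proof (rule span_minimal)
    have "filt S k \<subseteq> span (?P (Suc k))" unfolding Suc by (rule span_mono) auto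
    moreover have "a \<cdot> x \<in> span (?P (Suc k))" if "a \<in> S" "x \<in> filt S k" for a x
    proof (rule mult_left_in_subspace)
      fix y assume "y \<in> ?P k"
      then obtain as where "y = foldr (\<cdot>) as e" "set as \<subseteq> S" "length as \<le> k" by blast
      then have "a \<cdot> y = foldr (\<cdot>) (a # as) e \<and> set (a # as) \<subseteq> S \<and> length (a # as) \<le> Suc k"
        using that by simp
      then show "a \<cdot> y \<in> span (?P (Suc k))" by (blast intro: span_base)
    qed (use that Suc in simp_all)
    ultimately show "filt S k \<union> {a \<cdot> x |a x. a \<in> S \<and> x \<in> filt S k} \<subseteq> span (?P (Suc k))"
      by blast
  qed simp
  moreover have "foldr (\<cdot>) as e \<in> filt S (length as)" if "set as \<subseteq> S" for as
    using that by (induction as) (simp_all add: mult_letter_in_filt span_base del: filt.simps(2))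
  then have "?P (Suc k) \<subseteq> filt S (Suc k)" using filt_mono by blast
  then have "span (?P (Suc k)) \<subseteq> filt S (Suc k)" by (rule span_minimal) simp
  ultimately show ?case by blast
qed

text \<open>A product of two elements lies in step \<open>2 * length as\<close> of the filtration,
  but a subword never has more than \<open>length as\<close> letters.\<close>

lemma gen_closed: "x \<in> gen as \<Longrightarrow> y \<in> gen as \<Longrightarrow> x \<cdot> y \<in> gen as"
  using mult_in_filt[of x "set as" "length as" y "length as"]
    subwords_saturated[of as "length as + length as"]
  by (simp add: filt_eq_span_subwords)

lemma conj_in_gen: "x \<in> gen as \<Longrightarrow> x\<^bsup>c\<^esup> \<in> gen as"
  using conj_in_filt[of x "set as" "length as"] by (simp add: filt_eq_span_subwords)

section \<open>Irreducible words have independent subwords\<close>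

text \<open>Recursive rather than \<open>subwords\<close> with the full product deleted: if a
  shorter subsequence has the same value as the full word, that value must stay, for it shows that
  the word is reducible.\<close>

fun proper_subwords :: "'a list \<Rightarrow> 'a set" where
  "proper_subwords [] = {}"
| "proper_subwords (a # as) = subwords (length as) as \<union> (\<cdot>) a ` proper_subwords as"

lemma mult_in_span_proper_subwords:
  "z \<in> span (proper_subwords as) \<Longrightarrow> a \<cdot> z \<in> span (proper_subwords (a # as))"
  by (erule mult_left_in_subspace[OF subspace_span, rotated]) (auto intro: span_base)

lemma gen_subset_span_proper_subwords: "gen as \<subseteq> span (proper_subwords (a # as))"
  by (rule span_mono) auto

lemma foldr_mult_add: "foldr (\<cdot>) bs (x + y) = foldr (\<cdot>) bs x + foldr (\<cdot>) bs y"
  by (induction bs) (simp_all add: mult_simps)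

lemma foldr_mult_zero [simp]: "foldr (\<cdot>) bs 0 = 0"
  by (induction bs) simp_all

lemma foldr_mult_in_gen:
  "set bs \<subseteq> span (insert e (set as)) \<Longrightarrow> x \<in> gen as \<Longrightarrow> foldr (\<cdot>) bs x \<in> gen as"
  by (induction bs) (simp_all add: mult_in_gen)

lemma conj_in_span_letters: "x \<in> span (insert e X) \<Longrightarrow> x\<^bsup>c\<^esup> \<in> span (insert e X)"
  unfolding conj_eq by (intro span_diff span_scale) (auto intro: span_base)

text \<open>Moving letters past \<open>a\<close> conjugates them, which avoids signs and traces of \<open>a\<close>.\<close>

lemma foldr_conj_mult:
  assumes "set bs \<subseteq> span (insert e (set as))" and "y \<in> gen as"
  shows "foldr (\<cdot>) (map conj bs) (a \<cdot> y) - a \<cdot> foldr (\<cdot>) bs y \<in> gen as"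
  using assms(1)
proof (induction bs)
  case Nil
  then show ?case by (simp add: span_zero)
next
  case (Cons b bs)
  define w where "w = foldr (\<cdot>) bs y"
  define g where "g = foldr (\<cdot>) (map conj bs) (a \<cdot> y) - a \<cdot> w"
  have b: "b \<in> span (insert e (set as))" using Cons.prems by simp
  have w: "w \<in> gen as" unfolding w_def using Cons.prems assms(2) by (simp add: foldr_mult_in_gen)
  have g: "g \<in> gen as" using Cons unfolding g_def w_def by simp
  have "foldr (\<cdot>) (map conj (b # bs)) (a \<cdot> y) - a \<cdot> foldr (\<cdot>) (b # bs) y =
      b\<^bsup>c\<^esup> \<cdot> (g + a \<cdot> w) - a \<cdot> (b \<cdot> w)"
    by (simp add: g_def w_def)
  also have "\<dots> = b\<^bsup>c\<^esup> \<cdot> g + (\<langle>b,a\<rangle> *\<^sub>s w - trace a *\<^sub>s (b \<cdot> w))"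
    using left_exchange[of b a w] by (simp add: conj_eq[of b] mult_simps)
  finally show ?case
    using mult_in_gen[OF b w] mult_in_gen[OF conj_in_span_letters[OF b] g] w
    by (simp only: span_add span_diff span_scale)
qed

text \<open>Write \<open>z = x + a \<cdot> y\<close>. If \<open>y = 0\<close>, reach the full word
  of \<open>as\<close> from \<open>z\<close> and then multiply by \<open>a\<close>. Otherwise reach
  it from \<open>y\<close> and apply the conjugated multipliers to \<open>z\<close>: the part from
  \<open>x\<close> and the errors of \<open>foldr_conj_mult\<close> stay in \<open>gen as\<close>,
  hence are proper.\<close>

lemma full_word_reachable:
  assumes "z \<in> gen as" and "z \<noteq> 0"
  shows "\<exists>bs r. set bs \<subseteq> span (insert e (set as)) \<and> r \<noteq> 0 \<and>
    foldr (\<cdot>) bs z - r *\<^sub>s foldr (\<cdot>) as e \<in> span (proper_subwords as)"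
  using assms
proof (induction as arbitrary: z)
  case Nil
  then obtain r where "z = r *\<^sub>s e" by (auto simp: span_singleton)
  then show ?case using Nil by (intro exI[of _ "[]"] exI[of _ r]) auto
next
  case (Cons a as)
  obtain x y where z: "z = x + a \<cdot> y" and x: "x \<in> gen as" and y: "y \<in> gen as"
    using Cons.prems(1) unfolding gen_Cons by blast
  let ?p = "foldr (\<cdot>) as e"
  have letters: "span (insert e (set as)) \<subseteq> span (insert e (set (a # as)))"
    by (rule span_mono) auto
  show ?case
  proof (cases "y = 0")
    case True
    with Cons.prems z x have "z \<in> gen as" by simp
    then obtain bs r where bs: "set bs \<subseteq> span (insert e (set as))" and r: "r \<noteq> 0"
      and *: "foldr (\<cdot>) bs z - r *\<^sub>s ?p \<in> span (proper_subwords as)"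
      using Cons.IH Cons.prems by blast
    have "foldr (\<cdot>) (a # bs) z - r *\<^sub>s foldr (\<cdot>) (a # as) e = a \<cdot> (foldr (\<cdot>) bs z - r *\<^sub>s ?p)"
      by (simp add: mult_simps)
    with mult_in_span_proper_subwords[OF *, of a]
    have "foldr (\<cdot>) (a # bs) z - r *\<^sub>s foldr (\<cdot>) (a # as) e \<in> span (proper_subwords (a # as))"
      by simp
    moreover have "set (a # bs) \<subseteq> span (insert e (set (a # as)))"
      using bs letters by (auto intro: span_base)
    ultimately show ?thesis using r by blast
  next
    case False
    then obtain bs r where bs: "set bs \<subseteq> span (insert e (set as))" and r: "r \<noteq> 0"
      and *: "foldr (\<cdot>) bs y - r *\<^sub>s ?p \<in> span (proper_subwords as)"
      using Cons.IH y by blast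
    let ?bs = "map conj bs"
    have bs': "set ?bs \<subseteq> span (insert e (set as))" using bs conj_in_span_letters by auto
    have "foldr (\<cdot>) ?bs z - r *\<^sub>s foldr (\<cdot>) (a # as) e =
        (foldr (\<cdot>) ?bs x + (foldr (\<cdot>) ?bs (a \<cdot> y) - a \<cdot> foldr (\<cdot>) bs y)) +
        a \<cdot> (foldr (\<cdot>) bs y - r *\<^sub>s ?p)"
      by (simp add: z foldr_mult_add mult_simps)
    also have "\<dots> \<in> span (proper_subwords (a # as))"
      by (rule span_add[OF subsetD[OF gen_subset_span_proper_subwords
            span_add[OF foldr_mult_in_gen[OF bs' x] foldr_conj_mult[OF bs y]]]
            mult_in_span_proper_subwords[OF *]])
    finally show ?thesis using r bs' letters by blast
  qed
qed

text \<open>A relation \<open>x + a \<cdot> y = 0\<close> with \<open>y \<noteq> 0\<close> would,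
  after the left multiplications that carry \<open>y\<close> to the full word of \<open>as\<close>,
  express the full word of \<open>a # as\<close> by proper subwords. Irreducibility passes from
  \<open>a # as\<close> to \<open>as\<close>, so the doubling can be iterated.\<close>

lemma irreducible_word_independent:
  assumes "foldr (\<cdot>) as e \<notin> span (proper_subwords as)"
  shows "independent (subwords (length as) as) \<and> card (subwords (length as) as) = 2 ^ length as"
  using assms
proof (induction as)
  case Nil
  then show ?case using unity_nonzero by simp
next
  case (Cons a as)
  let ?p = "foldr (\<cdot>) as e"
  have IH: "independent (subwords (length as) as)" "card (subwords (length as) as) = 2 ^ length as"
    using Cons mult_in_span_proper_subwords[of ?p as a] by auto
  have "y = 0" if x: "x \<in> gen as" and y: "y \<in> gen as" and xy: "x + a \<cdot> y = 0" for x y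
  proof (rule ccontr)
    assume "y \<noteq> 0"
    then obtain bs r where bs: "set bs \<subseteq> span (insert e (set as))" and r: "r \<noteq> 0"
      and *: "foldr (\<cdot>) bs y - r *\<^sub>s ?p \<in> span (proper_subwords as)"
      using full_word_reachable y by blast
    let ?bs = "map conj bs"
    have bs': "set ?bs \<subseteq> span (insert e (set as))" using bs conj_in_span_letters by auto
    have "foldr (\<cdot>) ?bs x + foldr (\<cdot>) ?bs (a \<cdot> y) = 0"
      using xy by (simp flip: foldr_mult_add)
    then have "- (r *\<^sub>s foldr (\<cdot>) (a # as) e) =
        (foldr (\<cdot>) ?bs x + (foldr (\<cdot>) ?bs (a \<cdot> y) - a \<cdot> foldr (\<cdot>) bs y)) +
        a \<cdot> (foldr (\<cdot>) bs y - r *\<^sub>s ?p)"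
      by (simp add: mult_simps add_diff_eq)
    also have "\<dots> \<in> span (proper_subwords (a # as))"
      by (rule span_add[OF subsetD[OF gen_subset_span_proper_subwords
            span_add[OF foldr_mult_in_gen[OF bs' x] foldr_conj_mult[OF bs y]]]
            mult_in_span_proper_subwords[OF *]])
    finally have "(- inverse r) *\<^sub>s (- (r *\<^sub>s foldr (\<cdot>) (a # as) e)) \<in> span (proper_subwords (a # as))"
      by (rule span_scale)
    then show False using Cons.prems r by simp
  qed
  then show ?case
    unfolding subwords_full_Cons
    using independent_Un_image[OF linear_mult IH(1) finite_subwords, of a] IH(2) by simp
qed

lemma proper_subwords_subset_filt: "set (a # as) \<subseteq> S \<Longrightarrow> proper_subwords (a # as) \<subseteq> filt S (length as)"
proof (induction as arbitrary: a)
  case Nil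
  then show ?case by (simp add: span_base)
next
  case (Cons b as)
  have "gen (b # as) \<subseteq> filt S (length (b # as))"
    using Cons.prems by (intro span_subwords_subset_filt) (auto intro: span_base)
  then have "subwords (length (b # as)) (b # as) \<subseteq> filt S (length (b # as))"
    using span_superset by blast
  moreover have "a \<cdot> x \<in> filt S (length (b # as))" if "x \<in> proper_subwords (b # as)" for x
    using Cons.IH[of b] Cons.prems that mult_letter_in_filt[of a S x "length as"]
    by (auto intro: span_base simp del: filt.simps proper_subwords.simps)
  ultimately show ?case
    unfolding proper_subwords.simps(2)[of a "b # as"] by blast
qed

text \<open>
  If the filtration still grows at step \<open>m + 1\<close>, some word of length \<open>m + 1\<close> is irreducible and
  its \<open>2 ^ (m + 1)\<close> subwords are independent.
\<close>

lemma filt_stable_of_dim: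
  assumes fin: "finite G" "span G = UNIV" and dim: "dim UNIV < 2 ^ Suc m"
  shows "filt S (Suc m) = filt S m"
proof (rule ccontr)
  assume "filt S (Suc m) \<noteq> filt S m"
  have "\<exists>as. set as \<subseteq> S \<and> length as \<le> Suc m \<and> foldr (\<cdot>) as e \<notin> filt S m"
  proof (rule ccontr)
    assume "\<not> ?thesis"
    then have "{foldr (\<cdot>) as e | as. set as \<subseteq> S \<and> length as \<le> Suc m} \<subseteq> filt S m" by blast
    then have "filt S (Suc m) \<subseteq> filt S m"
      unfolding filt_eq_span_products[of S "Suc m"] by (rule span_minimal) (rule subspace_filt)
    with \<open>filt S (Suc m) \<noteq> filt S m\<close> filt_Suc[of S m] show False by (metis subset_antisym)
  qed
  then obtain as where as: "set as \<subseteq> S" "length as \<le> Suc m" "foldr (\<cdot>) as e \<notin> filt S m"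
    by blast
  have "length as = Suc m"
  proof (rule ccontr)
    assume "length as \<noteq> Suc m"
    with as(1,2) have "foldr (\<cdot>) as e \<in> {foldr (\<cdot>) as e | as. set as \<subseteq> S \<and> length as \<le> m}"
      by (intro CollectI exI[of _ as]) simp
    then have "foldr (\<cdot>) as e \<in> filt S m"
      unfolding filt_eq_span_products[of S m] by (rule span_base)
    with as(3) show False ..
  qed
  then obtain b bs where bs: "as = b # bs" "length bs = m" by (auto simp: length_Suc_conv)
  then have "proper_subwords as \<subseteq> filt S m"
    using proper_subwords_subset_filt[of b bs S] as(1) by simp
  then have "span (proper_subwords as) \<subseteq> filt S m" by (rule span_minimal) simp
  with as(3) have "foldr (\<cdot>) as e \<notin> span (proper_subwords as)" by blast
  note ind = irreducible_word_independent[OF this]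
  obtain B where B: "B \<subseteq> UNIV" "independent B" "UNIV \<subseteq> span B" "card B = dim UNIV"
    by (rule basis_exists)
  have "finite B" using independent_span_bound[OF fin(1) B(2)] fin(2) by simp
  moreover have "subwords (length as) as \<subseteq> span B" using B(3) by blast
  ultimately have "card (subwords (length as) as) \<le> card B"
    using independent_span_bound[OF _ ind[THEN conjunct1]] by simp
  then show False using ind B(4) dim \<open>length as = Suc m\<close> by simp
qed

section \<open>Hurwitz's theorem\<close>

text \<open>The state of the Cayley-Dickson process: full dimension \<open>2 ^ length as\<close>,
  and a norm form that is nondegenerate on \<open>gen as\<close>, which is what makes orthogonal
  projection onto it possible.\<close>

definition regular :: "'a list \<Rightarrow> bool" where
  "regular as \<longleftrightarrow> independent (subwords (length as) as) \<and>
     card (subwords (length as) as) = 2 ^ length as \<and>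
     (\<forall>x\<in>gen as. (\<forall>y\<in>gen as. \<langle>x,y\<rangle> = 0) \<longrightarrow> x = 0)"

lemma linear_polar: "Vector_Spaces.linear scale (*) (polar_form a)"
  using linear_polar_right[of a] by simp

lemma orthogonal_span: "(\<And>y. y \<in> X \<Longrightarrow> \<langle>a,y\<rangle> = 0) \<Longrightarrow> y \<in> span X \<Longrightarrow> \<langle>a,y\<rangle> = 0"
proof -
  interpret f: Vector_Spaces.linear scale "(*)" "polar_form a" by (rule linear_polar)
  show "(\<And>y. y \<in> X \<Longrightarrow> \<langle>a,y\<rangle> = 0) \<Longrightarrow> y \<in> span X \<Longrightarrow> \<langle>a,y\<rangle> = 0"
    by (rule f.eq_0_on_span)
qed

text \<open>The search takes place inside \<open>span (insert x ?B)\<close>, which is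
  finite-dimensional even if the algebra is not: it has one dimension more than there are
  conditions. The solution \<open>w\<close> involves \<open>x\<close> because the form is
  nondegenerate on \<open>gen as\<close>.\<close>

lemma orthogonal_projection:
  assumes "regular as"
  shows "\<exists>b\<in>gen as. \<forall>y\<in>gen as. \<langle>x - b,y\<rangle> = 0"
proof (cases "x \<in> gen as")
  case True
  then show ?thesis by (intro bexI[of _ x]) simp_all
next
  case False
  let ?B = "subwords (length as) as"
  have ind: "independent (insert x ?B)"
    using False assms by (simp add: regular_def independent_insertI)
  have "x \<notin> ?B" using False span_base by blast
  then have "card ?B < dim (span (insert x ?B))"
    using dim_span_eq_card_independent[OF ind] by simp
  moreover have "Vector_Spaces.linear scale (*) (\<lambda>w. \<langle>w,b\<rangle>)" for b
    by (rule linear_polar_left)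
  ultimately obtain w where w: "w \<in> span (insert x ?B)" "w \<noteq> 0" and orth: "\<And>b. b \<in> ?B \<Longrightarrow> \<langle>w,b\<rangle> = 0"
    using common_zero_exists[of ?B "\<lambda>b w. \<langle>w,b\<rangle>" "span (insert x ?B)" "insert x ?B"] by auto
  have orth': "\<langle>w,y\<rangle> = 0" if "y \<in> gen as" for y
    using orthogonal_span[OF orth that] .
  obtain r where r: "w - r *\<^sub>s x \<in> gen as" using w(1) unfolding span_insert by blast
  have "r \<noteq> 0"
  proof
    assume "r = 0"
    then have "w \<in> gen as" using r by simp
    then show False using assms orth' w(2) by (auto simp: regular_def)
  qed
  let ?b = "(- inverse r) *\<^sub>s (w - r *\<^sub>s x)"
  have "?b \<in> gen as" using r by (rule span_scale)
  moreover have "x - ?b = inverse r *\<^sub>s w" using \<open>r \<noteq> 0\<close> by (simp add: scale_right_diff_distrib)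
  ultimately show ?thesis using orth' by (intro bexI[of _ ?b]) (simp_all add: polar_simps)
qed

text \<open>If \<open>n\<close> vanished on the orthogonal complement, so would its polar form
  there. The component of any \<open>x\<close> in the complement would then be orthogonal to
  everything, hence zero.\<close>

lemma anisotropic_orthogonal_exists:
  assumes "regular as" and "gen as \<noteq> UNIV"
  shows "\<exists>v. (\<forall>y\<in>gen as. \<langle>v,y\<rangle> = 0) \<and> n v \<noteq> 0"
proof (rule ccontr)
  assume *: "\<not> ?thesis"
  obtain x where x: "x \<notin> gen as" using assms(2) by blast
  obtain b where b: "b \<in> gen as" "\<forall>y\<in>gen as. \<langle>x - b,y\<rangle> = 0"
    using orthogonal_projection[OF assms(1)] by blast
  have "\<langle>x - b,y\<rangle> = 0" for y
  proof -
    obtain c where c: "c \<in> gen as" "\<forall>z\<in>gen as. \<langle>y - c,z\<rangle> = 0"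
      using orthogonal_projection[OF assms(1)] by blast
    have "n (x - b) = 0" "n (y - c) = 0" using * b c by blast+
    moreover have "\<forall>z\<in>gen as. \<langle>(x - b) + (y - c),z\<rangle> = 0" using b(2) c(2) by (simp add: polar_add_left)
    then have "n ((x - b) + (y - c)) = 0" using * by blast
    ultimately have "\<langle>x - b,y - c\<rangle> = 0" by (simp add: polar_def)
    then show ?thesis using b(2) c(1) by (simp add: polar_diff(1)[of "x - b"])
  qed
  then have "x - b = 0" by (rule polar_nondegenerate)
  then show False using x b(1) by simp
qed

text \<open>If conjugation were trivial, then \<open>trace x *\<^sub>s e = 2 *\<^sub>s x\<close> on
  \<open>gen as\<close>. In characteristic 2 this puts \<open>e\<close> into the radical; otherwise
  it squeezes \<open>gen as\<close> into the line of \<open>e\<close>.\<close>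

lemma conj_nontrivial:
  assumes reg: "regular as" and "as \<noteq> []"
  shows "\<exists>x\<in>gen as. x\<^bsup>c\<^esup> \<noteq> x"
proof (rule ccontr)
  assume "\<not> ?thesis"
  then have eq: "trace x *\<^sub>s e = 2 *\<^sub>s x" if "x \<in> gen as" for x
    using that scale_left_distrib[of 1 1 x] by (auto simp: conj_eq algebra_simps)
  have e: "e \<in> gen as" by (simp add: span_base)
  show False
  proof (cases "(2 :: 'f) = 0")
    case True
    then have "trace x = 0" if "x \<in> gen as" for x using eq[OF that] unity_nonzero by simp
    then have "\<forall>y\<in>gen as. \<langle>e,y\<rangle> = 0" by (simp add: polar_commute)
    then have "e = 0" using reg e unfolding regular_def by blast
    then show False using unity_nonzero by simp
  next
    case False
    have "x \<in> span {e}" if "x \<in> gen as" for x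
    proof -
      have "x = inverse 2 *\<^sub>s (2 *\<^sub>s x)" using False by simp
      then have "x = (inverse 2 * trace x) *\<^sub>s e" by (simp flip: eq[OF that])
      then show ?thesis unfolding span_singleton by blast
    qed
    then have "subwords (length as) as \<subseteq> span {e}" using span_base by blast
    then have "2 ^ length as \<le> card {e}"
      using independent_span_bound[of "{e}" "subwords (length as) as"] reg by (simp add: regular_def)
    moreover have "2 ^ 1 \<le> (2::nat) ^ length as"
      using assms(2) by (intro power_increasing) (cases as, auto)
    ultimately show False by simp
  qed
qed

section \<open>Cayley-Dickson doubling by an anisotropic vector orthogonal to
  \<open>gen as\<close>\<close>

context
  fixes as :: "'a list" and v :: 'a
  assumes reg: "regular as" and orth: "\<And>y. y \<in> gen as \<Longrightarrow> \<langle>v,y\<rangle> = 0" and anis: "n v \<noteq> 0"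
begin

lemma trace_orthogonal: "trace v = 0"
  using orth[of e] by (simp add: span_base)

lemma orthogonal_commute: "x \<in> gen as \<Longrightarrow> v \<cdot> x = x\<^bsup>c\<^esup> \<cdot> v"
  using orth[of x] anticommutator[of v x] trace_orthogonal
  by (simp add: conj_eq mult_simps polar_commute)

lemma orthogonal_mult_right:
  assumes x: "x \<in> gen as" and y: "y \<in> gen as"
  shows "x \<cdot> (y \<cdot> v) = (y \<cdot> x) \<cdot> v"
proof -
  have "x \<cdot> (y \<cdot> v) = x \<cdot> (v \<cdot> y\<^bsup>c\<^esup>)"
    using orthogonal_commute[OF conj_in_gen[OF y]] by simp
  also have "\<dots> = v \<cdot> (x\<^bsup>c\<^esup> \<cdot> y\<^bsup>c\<^esup>)"
    using left_exchange[of x v "y\<^bsup>c\<^esup>"] orth[OF x] trace_orthogonal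
    by (simp add: conj_eq[of x] mult_simps polar_commute[of x])
  also have "\<dots> = (y \<cdot> x) \<cdot> v"
    using orthogonal_commute[OF conj_in_gen[OF gen_closed[OF y x]]] by (simp add: conj_mult)
  finally show ?thesis .
qed

lemma orthogonal_mult_left: "x \<in> gen as \<Longrightarrow> y \<in> gen as \<Longrightarrow> \<langle>x,v \<cdot> y\<rangle> = 0"
  using orth[of "x \<cdot> y\<^bsup>c\<^esup>"] polar_adjoint_right[of v y x]
  by (simp add: conj_in_gen gen_closed polar_commute)

text \<open>The halves \<open>gen as\<close> and \<open>v \<cdot> gen as\<close> are orthogonal, and
  left multiplication by \<open>v\<close> scales the form by \<open>n v \<noteq> 0\<close>. The
  single computation \<open>y0\<close> yields both that the sum is direct and that the form is
  nondegenerate on it.\<close>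

lemma regular_Cons: "regular (v # as)"
proof -
  have nondeg: "y = 0" if "y \<in> gen as" "\<And>z. z \<in> gen as \<Longrightarrow> \<langle>y,z\<rangle> = 0" for y
    using reg that by (simp add: regular_def)
  have y0: "y = 0" if "x \<in> gen as" "y \<in> gen as" and *: "\<And>z. z \<in> gen as \<Longrightarrow> \<langle>x + v \<cdot> y,v \<cdot> z\<rangle> = 0" for x y
  proof (rule nondeg[OF that(2)])
    fix z assume "z \<in> gen as"
    then show "\<langle>y,z\<rangle> = 0"
      using *[of z] orthogonal_mult_left[OF that(1)] anis
      by (simp add: polar_add_left polar_mult_left)
  qed
  have "independent (subwords (length (v # as)) (v # as)) \<and>
      card (subwords (length (v # as)) (v # as)) = 2 ^ length (v # as)"
    unfolding subwords_full_Cons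
    using independent_Un_image[OF linear_mult[of v], where B = "subwords (length as) as"] reg y0
    by (simp add: regular_def)
  moreover have "w = 0" if w: "w \<in> gen (v # as)" "\<And>z. z \<in> gen (v # as) \<Longrightarrow> \<langle>w,z\<rangle> = 0" for w
  proof -
    obtain x y where xy: "w = x + v \<cdot> y" "x \<in> gen as" "y \<in> gen as"
      using w(1) unfolding gen_Cons by blast
    have in1: "z \<in> gen (v # as)" and in2: "v \<cdot> z \<in> gen (v # as)" if "z \<in> gen as" for z
      using that span_zero unfolding gen_Cons by (force, force)
    have "y = 0" using y0 xy w(2) in2 by simp
    then have "x = 0" using nondeg xy w(2) in1 by simp
    then show "w = 0" using xy \<open>y = 0\<close> by simp
  qed
  ultimately show ?thesis by (simp add: regular_def)
qed

lemma orthogonal_mult_commute: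
  assumes "b \<in> gen as" "c \<in> gen as"
  shows "(b \<cdot> v) \<cdot> c = (b \<cdot> c\<^bsup>c\<^esup>) \<cdot> v"
proof -
  have bv: "b \<cdot> v = v \<cdot> b\<^bsup>c\<^esup>"
    using orthogonal_commute[OF conj_in_gen[OF assms(1)]] by simp
  have *: "\<langle>x,b \<cdot> v\<rangle> = 0" if "x \<in> gen as" for x
    using that assms(1) orthogonal_mult_left unfolding bv by (simp add: conj_in_gen)
  have "trace (b \<cdot> v) = 0" using *[of e] by (simp add: polar_commute span_base)
  then have "(b \<cdot> v) \<cdot> c = c\<^bsup>c\<^esup> \<cdot> (b \<cdot> v)"
    using *[OF assms(2)] anticommutator[of "b \<cdot> v" c] by (simp add: conj_eq[of c] mult_simps)
  then show ?thesis using orthogonal_mult_right[OF conj_in_gen[OF assms(2)] assms(1)] by simp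
qed

text \<open>The mere existence of \<open>v\<close> forces associativity one level below:
  \<open>polar_exchange\<close> for \<open>a\<close>, \<open>c\<close>, \<open>b \<cdot> v\<close>,
  \<open>d \<cdot> v\<close> has right-hand side 0, and moving \<open>v\<close> out of both terms
  compares \<open>d \<cdot> (a \<cdot> c)\<close> with \<open>(d \<cdot> a) \<cdot> c\<close>
  against every \<open>b\<close>.\<close>

lemma gen_associative:
  assumes a: "a \<in> gen as" and c: "c \<in> gen as" and d: "d \<in> gen as"
  shows "d \<cdot> (a \<cdot> c) = (d \<cdot> a) \<cdot> c"
proof -
  have bv: "b \<cdot> v = v \<cdot> b\<^bsup>c\<^esup>" if "b \<in> gen as" for b
    using orthogonal_commute[OF conj_in_gen[OF that]] by simp
  have perp: "\<langle>x,b \<cdot> v\<rangle> = 0" if "b \<in> gen as" "x \<in> gen as" for b x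
    using orthogonal_mult_left[OF that(2) conj_in_gen[OF that(1)]] bv[OF that(1)] by simp
  have *: "\<langle>d \<cdot> (a \<cdot> c) - (d \<cdot> a) \<cdot> c,b\<rangle> = 0" if b: "b \<in> gen as" for b
  proof -
    have "trace (b \<cdot> v) = 0"
      using perp[OF b, of e] by (simp add: polar_commute span_base)
    then have "\<langle>a \<cdot> c,(b \<cdot> v) \<cdot> (d \<cdot> v)\<rangle> = - \<langle>d \<cdot> v,(b \<cdot> v) \<cdot> (a \<cdot> c)\<rangle>"
      using polar_adjoint_left[of "b \<cdot> v" "d \<cdot> v" "a \<cdot> c"]
      by (simp add: polar_commute[of "a \<cdot> c"] conj_eq[of "b \<cdot> v"] mult_minus_left polar_minus)
    also have "\<dots> = - (\<langle>d,b \<cdot> (a \<cdot> c)\<^bsup>c\<^esup>\<rangle> * n v)"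
      by (simp add: orthogonal_mult_commute[OF b gen_closed[OF a c]] polar_mult_right)
    finally have 1: "\<langle>a \<cdot> c,(b \<cdot> v) \<cdot> (d \<cdot> v)\<rangle> = - (\<langle>d,b \<cdot> (a \<cdot> c)\<^bsup>c\<^esup>\<rangle> * n v)" .
    have 2: "\<langle>a \<cdot> (d \<cdot> v),(b \<cdot> v) \<cdot> c\<rangle> = \<langle>d \<cdot> a,b \<cdot> c\<^bsup>c\<^esup>\<rangle> * n v"
      by (simp add: orthogonal_mult_commute[OF b c] orthogonal_mult_right[OF a d] polar_mult_right)
    have "\<langle>a \<cdot> c,(b \<cdot> v) \<cdot> (d \<cdot> v)\<rangle> + \<langle>a \<cdot> (d \<cdot> v),(b \<cdot> v) \<cdot> c\<rangle> = 0"
      using polar_exchange[of a c "b \<cdot> v" "d \<cdot> v"] perp[OF b a] by simp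
    then have "\<langle>d \<cdot> a,b \<cdot> c\<^bsup>c\<^esup>\<rangle> * n v = \<langle>d,b \<cdot> (a \<cdot> c)\<^bsup>c\<^esup>\<rangle> * n v" unfolding 1 2 by simp
    then have "\<langle>d \<cdot> a,b \<cdot> c\<^bsup>c\<^esup>\<rangle> = \<langle>d,b \<cdot> (a \<cdot> c)\<^bsup>c\<^esup>\<rangle>" using anis by simp
    then show ?thesis
      using polar_adjoint_right[of "d \<cdot> a" c b] polar_adjoint_right[of d "a \<cdot> c" b]
      by (simp add: polar_diff)
  qed
  have "d \<cdot> (a \<cdot> c) - (d \<cdot> a) \<cdot> c \<in> gen as"
    using a c d by (intro span_diff gen_closed)
  then have "d \<cdot> (a \<cdot> c) - (d \<cdot> a) \<cdot> c = 0" using reg * unfolding regular_def by blast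
  then show ?thesis by simp
qed

lemma mult_right_cancel:
  assumes "x \<cdot> v = y \<cdot> v"
  shows "x = y"
proof -
  have "n v *\<^sub>s x = n v *\<^sub>s y"
    unfolding conj_mult_cancel_right[symmetric] assms ..
  then show ?thesis using anis by simp
qed

lemma gen_subset_gen_Cons: "gen as \<subseteq> gen (v # as)"
  by (rule span_mono) (simp only: subwords_full_Cons Un_upper1)

lemma letter_in_gen_Cons: "v \<in> gen (v # as)"
proof -
  have "v \<in> span (insert e (set (v # as)))" by (rule span_base) simp
  from mult_in_gen[OF this span_base[OF unit_in_subwords]] show ?thesis by (simp only: unit_right)
qed

text \<open>Since \<open>v \<cdot> x\<close> is the conjugate of \<open>x\<close> times
  \<open>v\<close>, any \<open>x\<close> moved by conjugation fails to commute with
  \<open>v\<close>.\<close>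

lemma noncommutative_Cons:
  assumes "as \<noteq> []"
  shows "\<exists>x\<in>gen (v # as). \<exists>y\<in>gen (v # as). x \<cdot> y \<noteq> y \<cdot> x"
proof -
  obtain x where x: "x \<in> gen as" "x\<^bsup>c\<^esup> \<noteq> x" using conj_nontrivial[OF reg assms] by blast
  then have "v \<cdot> x \<noteq> x \<cdot> v" using orthogonal_commute[OF x(1)] mult_right_cancel by metis
  then show ?thesis using x(1) gen_subset_gen_Cons letter_in_gen_Cons by blast
qed

text \<open>By \<open>orthogonal_mult_right\<close> the product
  \<open>x \<cdot> (y \<cdot> v)\<close> equals \<open>(y \<cdot> x) \<cdot> v\<close>, with
  \<open>x\<close> and \<open>y\<close> in the wrong order.\<close>

lemma nonassociative_Cons:
  assumes "x \<in> gen as" "y \<in> gen as" "x \<cdot> y \<noteq> y \<cdot> x"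
  shows "\<exists>x\<in>gen (v # as). \<exists>y\<in>gen (v # as). \<exists>z\<in>gen (v # as). x \<cdot> (y \<cdot> z) \<noteq> (x \<cdot> y) \<cdot> z"
proof -
  have "x \<cdot> (y \<cdot> v) \<noteq> (x \<cdot> y) \<cdot> v"
    using orthogonal_mult_right[OF assms(1,2)] assms(3) mult_right_cancel by metis
  then show ?thesis using assms(1,2) gen_subset_gen_Cons letter_in_gen_Cons by blast
qed

end

lemma regular_Nil:
  assumes "(2 :: 'f) \<noteq> 0"
  shows "regular []"
  using assms unity_nonzero by (auto simp: regular_def span_singleton polar_simps trace_unit)

text \<open>In characteristic 2 the polar form vanishes on the line of \<open>e\<close>, so doubling
  has to start in dimension 2. A vector of trace 1 makes \<open>a\<close>, \<open>e\<close> a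
  hyperbolic pair.\<close>

lemma regular_singleton:
  assumes "(2 :: 'f) = 0"
  shows "\<exists>a. regular [a]"
proof -
  obtain b where b: "\<langle>e,b\<rangle> \<noteq> 0" using polar_nondegenerate[of e] unity_nonzero by blast
  define a where "a = inverse \<langle>e,b\<rangle> *\<^sub>s b"
  have a: "trace a = 1" using b by (simp add: a_def polar_simps polar_commute[of b])
  have e: "trace e = 0" using assms by (simp add: trace_unit)
  have aa: "\<langle>a,a\<rangle> = 0" using assms by (simp add: polar_self)
  have "a \<notin> span {e}" using a e by (auto simp: span_singleton polar_simps)
  then have ind: "independent {a, e}" using unity_nonzero by (simp add: independent_insertI)
  have "a \<noteq> e" using a e by auto
  have "x = 0" if x: "x \<in> span {a, e}" and orth: "\<And>y. y \<in> span {a, e} \<Longrightarrow> \<langle>x,y\<rangle> = 0" for x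
  proof -
    obtain p q where "x - p *\<^sub>s a = q *\<^sub>s e"
      using x by (auto simp: span_insert span_singleton)
    then have x: "x = p *\<^sub>s a + q *\<^sub>s e" by (simp add: diff_eq_eq add.commute)
    have "\<langle>x,a\<rangle> = 0" "\<langle>x,e\<rangle> = 0" using orth by (simp_all add: span_base)
    then show "x = 0" using a e aa by (simp add: x polar_simps polar_commute[of e a])
  qed
  moreover have "subwords (length [a]) [a] = {a, e}" by auto
  ultimately have "regular [a]"
    using ind \<open>a \<noteq> e\<close> unfolding regular_def by simp
  then show ?thesis ..
qed

text \<open>The last clause stops the process: doubling a noncommutative \<open>gen as\<close> gives
  a nonassociative algebra, and \<open>gen_associative\<close> forbids doubling that once
  more.\<close>

lemma regular_extension:
  assumes "regular as" "gen as \<noteq> UNIV"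
  shows "\<exists>v. regular (v # as) \<and>
    (as \<noteq> [] \<longrightarrow> (\<exists>x\<in>gen (v # as). \<exists>y\<in>gen (v # as). x \<cdot> y \<noteq> y \<cdot> x)) \<and>
    ((\<exists>x\<in>gen as. \<exists>y\<in>gen as. x \<cdot> y \<noteq> y \<cdot> x) \<longrightarrow> gen (v # as) = UNIV)"
proof -
  obtain v where v: "\<And>y. y \<in> gen as \<Longrightarrow> \<langle>v,y\<rangle> = 0" "n v \<noteq> 0"
    using anisotropic_orthogonal_exists[OF assms] by blast
  have reg: "regular (v # as)" using regular_Cons[OF assms(1) v] .
  have "gen (v # as) = UNIV" if nc: "x \<in> gen as" "y \<in> gen as" "x \<cdot> y \<noteq> y \<cdot> x" for x y
  proof (rule ccontr)
    assume "gen (v # as) \<noteq> UNIV"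
    then obtain u where "\<And>y. y \<in> gen (v # as) \<Longrightarrow> \<langle>u,y\<rangle> = 0" "n u \<noteq> 0"
      using anisotropic_orthogonal_exists[OF reg] by blast
    from gen_associative[OF reg this] nonassociative_Cons[OF assms(1) v nc] show False by blast
  qed
  then show ?thesis using reg noncommutative_Cons[OF assms(1) v] by blast
qed

text \<open>After one letter conjugation is nontrivial, after two the product is noncommutative, and
  a third letter exhausts the algebra. Besides the dimension this supplies the finite spanning sets
  and the letters used from here on.\<close>

lemma hurwitz:
  "\<exists>as. length as \<le> 3 \<and> gen as = UNIV \<and> regular as \<and> dim UNIV = 2 ^ length as"
proof -
  have dim: "dim UNIV = 2 ^ length as" if "regular as" "gen as = UNIV" for as
    using that dim_span_eq_card_independent[of "subwords (length as) as"] by (simp add: regular_def)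
  have step: "\<exists>as. length as \<le> 3 \<and> gen as = UNIV \<and> regular as" if a: "regular [a]" for a
  proof (cases "gen [a] = UNIV")
    case True
    then show ?thesis using a by (intro exI[of _ "[a]"]) simp
  next
    case False
    obtain b where b: "regular [b, a]" and nc: "\<exists>x\<in>gen [b, a]. \<exists>y\<in>gen [b, a]. x \<cdot> y \<noteq> y \<cdot> x"
      using regular_extension[OF a False] by blast
    show ?thesis
    proof (cases "gen [b, a] = UNIV")
      case True
      then show ?thesis using b by (intro exI[of _ "[b, a]"]) simp
    next
      case False
      obtain c where "regular [c, b, a]" "gen [c, b, a] = UNIV"
        using regular_extension[OF b False] nc by blast
      then show ?thesis by (intro exI[of _ "[c, b, a]"]) simp
    qed
  qed
  have "\<exists>as. length as \<le> 3 \<and> gen as = UNIV \<and> regular as"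
  proof (cases "(2 :: 'f) = 0")
    case True
    then show ?thesis using regular_singleton step by blast
  next
    case False
    show ?thesis
    proof (cases "gen [] = UNIV")
      case True
      then show ?thesis using regular_Nil[OF False] by (intro exI[of _ "[]"]) simp
    next
      case nU: False
      then show ?thesis using regular_extension[OF regular_Nil[OF False] nU] step by blast
    qed
  qed
  then show ?thesis using dim by blast
qed

end

section \<open>Lengths\<close>

context vector_space
begin

lemma L_upto_mono: "i \<le> j \<Longrightarrow> L_upto scale f S i \<subseteq> L_upto scale f S j"
  unfolding L_upto_def by (intro span_mono) (auto intro: order_trans)

lemma subspace_L_upto [simp]: "subspace (L_upto scale f S k)"
  by (simp add: L_upto_def)

lemma L_upto_subset_L_infty: "L_upto scale f S k \<subseteq> L_infty scale f S"
  by (auto simp: L_infty_def)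

text \<open>The uniform bound \<open>m\<close> makes the set of lengths finite, so that
  \<open>Max\<close> is meaningful; \<open>S\<close> shows that the bound is attained.\<close>

lemma alg_length_eqI:
  assumes upper: "\<And>S. generating scale f S \<Longrightarrow> L_upto scale f S m = UNIV"
    and "generating scale f S" and lower: "\<And>k. k < m \<Longrightarrow> L_upto scale f S k \<noteq> UNIV"
  shows "alg_length scale f = m"
  unfolding alg_length_def
proof (rule Max_eqI)
  have le: "set_length scale f S' \<le> m" if "generating scale f S'" for S'
    using upper[OF that] that by (auto simp: set_length_def generating_def intro: Least_le)
  then show "finite {set_length scale f S' |S'. generating scale f S'}"
    by (auto intro: finite_subset[of _ "{..m}"])
  show "y \<le> m" if "y \<in> {set_length scale f S' |S'. generating scale f S'}" for y
    using that le by blast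
  have "set_length scale f S = m"
    unfolding set_length_def using assms(2) upper[OF assms(2)] lower
    by (intro Least_equality) (auto simp: generating_def not_less[symmetric])
  then show "m \<in> {set_length scale f S' |S'. generating scale f S'}" using assms(2) by blast
qed

end

context hurwitz_algebra
begin

lemma word_in_filt: "word (\<cdot>) S i x \<Longrightarrow> x \<in> filt S i"
proof (induction rule: word.induct)
  case (word_unity u)
  then have "u = e" by (metis is_unity_def unit_left)
  then show ?case by (simp add: span_base)
next
  case (word_gen a)
  then show ?case using span_letters_subset_filt[of S] span_base[of a "insert e S"] by auto
next
  case (word_mult i a j b)
  then show ?case by (simp add: mult_in_filt)
qed

lemma word_foldr: "set as \<subseteq> S \<Longrightarrow> word (\<cdot>) S (length as) (foldr (\<cdot>) as e)"
proof (induction as)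
  case Nil
  then show ?case using unity by (auto intro: word_unity)
next
  case (Cons a as)
  show ?case
  \<comment> \<open>A one-letter word must come from \<open>word_gen\<close>:
    \<open>word_mult\<close> does not accept the unit, of length 0, as a factor.\<close>
  proof (cases "as = []")
    case True
    then show ?thesis using Cons.prems word_gen[of a S "(\<cdot>)"] by simp
  next
    case False
    then have "1 \<le> length as" by (cases as) auto
    then show ?thesis
      using word_mult[OF word_gen[of a S "(\<cdot>)"] Cons.IH] Cons.prems by simp
  qed
qed

lemma L_upto_mult: "L_upto scale (\<cdot>) S k = filt S k"
proof
  have "{a. \<exists>i\<le>k. word (\<cdot>) S i a} \<subseteq> filt S k" using word_in_filt filt_mono[of _ k S] by blast
  then show "L_upto scale (\<cdot>) S k \<subseteq> filt S k"
    unfolding L_upto_def by (rule span_minimal) simp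
  show "filt S k \<subseteq> L_upto scale (\<cdot>) S k"
    unfolding L_upto_def filt_eq_span_products using word_foldr by (intro span_mono) blast
qed

lemma filt_full:
  assumes "finite G" "span G = UNIV" "dim UNIV = 2 ^ m" and union: "(\<Union>k. filt S k) = UNIV"
  shows "filt S m = UNIV"
proof -
  have stable: "filt S (Suc m) = filt S m"
    using assms by (intro filt_stable_of_dim[of G]) simp_all
  have "filt S k \<subseteq> filt S m" for k
  proof (cases "k \<le> m")
    case False
    then show ?thesis using filt_stable[OF stable, of k] by simp
  qed (rule filt_mono)
  then show ?thesis using union by blast
qed

lemma dim_filt_le: "S \<subseteq> span (insert e (set as)) \<Longrightarrow> dim (filt S k) \<le> (\<Sum>i\<le>k. length as choose i)"
  using dim_le_card[OF filt_subset_span_subwords finite_subwords] card_subwords_le le_trans by blast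

text \<open>Fewer than \<open>length as\<close> letters give fewer than \<open>2 ^ length as\<close>
  subwords. Allowing \<open>e\<close> in \<open>S\<close> serves types II and IV, where the slow
  generating set contains it.\<close>

lemma filt_proper:
  assumes "dim UNIV = 2 ^ length as" "k < length as" "S \<subseteq> span (insert e (set as))"
  shows "filt S k \<noteq> UNIV"
proof
  assume "filt S k = UNIV"
  then have "2 ^ length as \<le> (\<Sum>i\<le>k. length as choose i)"
    using dim_filt_le[OF assms(3), of k] assms(1) by simp
  also have "\<dots> < (\<Sum>i\<le>length as. length as choose i)"
    using assms(2) by (intro sum_strict_mono2[where b = "length as"]) auto
  finally show False by (simp add: choose_row_sum)
qed

lemma alg_length_mult:
  assumes "dim UNIV = 2 ^ m"
  shows "alg_length scale (\<cdot>) = m"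
proof -
  obtain as where as: "gen as = UNIV" "dim UNIV = 2 ^ length as" using hurwitz by blast
  have m: "length as = m" using as(2) assms by simp
  show ?thesis
  proof (rule alg_length_eqI)
    fix S assume "generating scale (\<cdot>) S"
    then have "(\<Union>k. filt S k) = UNIV" by (simp add: generating_def L_infty_def L_upto_mult)
    then show "L_upto scale (\<cdot>) S m = UNIV"
      using filt_full[OF finite_subwords as(1) assms] by (simp add: L_upto_mult)
  next
    have "L_upto scale (\<cdot>) (set as) m = UNIV"
      using as(1) by (simp add: L_upto_mult filt_eq_span_subwords m)
    then show "generating scale (\<cdot>) (set as)"
      using L_upto_subset_L_infty[of "(\<cdot>)" "set as" m] by (auto simp: generating_def)
    show "L_upto scale (\<cdot>) (set as) k \<noteq> UNIV" if "k < m" for k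
      using filt_proper[OF as(2), of k "set as"] that m span_superset[of "insert e (set as)"]
      by (simp add: L_upto_mult)
  qed
qed

lemma unit_in_subspace:
  assumes "subspace U" "y \<in> U" "y - r *\<^sub>s e \<in> U" "r \<noteq> 0"
  shows "e \<in> U"
proof -
  have "inverse r *\<^sub>s (y - (y - r *\<^sub>s e)) \<in> U"
    by (rule subspace_scale[OF assms(1) subspace_diff[OF assms(1-3)]])
  then show ?thesis using assms(4) by simp
qed

lemma dim_UNIV_le_Suc:
  assumes "span (insert x X) = UNIV"
  shows "dim UNIV \<le> Suc (dim X)"
proof -
  obtain B where B: "B \<subseteq> X" "independent B" "X \<subseteq> span B" "card B = dim X"
    by (rule basis_exists)
  obtain as' where "gen as' = UNIV" using hurwitz by blast
  then have "finite B" using independent_span_bound[OF finite_subwords B(2), of "length as'" as'] by simp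
  have "insert x X \<subseteq> span (insert x B)"
    using B(3) span_mono[of B "insert x B"] by (auto intro: span_base)
  then have "UNIV \<subseteq> span (insert x B)" using span_minimal[OF _ subspace_span] assms by blast
  then have "dim UNIV \<le> card (insert x B)" using \<open>finite B\<close> by (intro dim_le_card) auto
  also have "\<dots> \<le> Suc (dim X)" using \<open>finite B\<close> B(4) by (simp add: card_insert_if)
  finally show ?thesis .
qed

lemma conj_not_identity:
  assumes "2 \<le> dim UNIV"
  shows "\<exists>x. x\<^bsup>c\<^esup> \<noteq> x"
proof -
  obtain as where as: "regular as" "dim UNIV = 2 ^ length as" using hurwitz by blast
  then have "as \<noteq> []" using assms by auto
  then show ?thesis using conj_nontrivial[OF as(1)] by blast
qed

end

section \<open>Standard composition algebras of types II and IV\<close>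

text \<open>
  What types II and IV have in common: \<open>Q\<close> is \<open>n\<close> for type II and \<open>t\<^sup>2 - n\<close> for type IV, where
  \<open>t\<close> is the trace.
\<close>

locale twisted_hurwitz_algebra = hurwitz_algebra scale mult n e
  for scale :: "'f::field \<Rightarrow> 'a::ab_group_add \<Rightarrow> 'a" and mult n e +
  fixes star :: "'a \<Rightarrow> 'a \<Rightarrow> 'a" and Q :: "'a \<Rightarrow> 'f"
  assumes dim_ge_2: "2 \<le> dim UNIV"
    and star_algebra: "nonassoc_algebra scale star"
    and star_in_filt: "x \<in> filt S i \<Longrightarrow> y \<in> filt S j \<Longrightarrow> star x y \<in> filt S (i + j)"
    and mult_in_span_star: "mult x y \<in> span {e, x, y, star x y}"
    and no_unity: "\<not> is_unity star u"
    and star_self: "star x x - Q x *\<^sub>s e \<in> span {x}"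
    and star_swap: "star x y + star y x - polar Q x y *\<^sub>s e \<in> span {x, y}"
    and linear_polar_Q: "Vector_Spaces.linear scale (*) (polar Q x)"
    and polar_Q_radical: "(\<And>y. polar Q x y = 0) \<Longrightarrow> x \<in> span {e}"
    and star_star_left: "Q x = 0 \<Longrightarrow> polar Q x y = 0 \<Longrightarrow> star x (star x y) \<in> span {x, y, star x y}"
    and star_star_right: "Q x = 0 \<Longrightarrow> polar Q x y = 0 \<Longrightarrow> star (star x y) x \<in> span {x, y, star x y}"
begin

sublocale star: nonassoc_algebra scale star
  by (rule star_algebra)

abbreviation L :: "'a set \<Rightarrow> nat \<Rightarrow> 'a set" where
  "L S k \<equiv> L_upto scale star S k"

lemma word_star: "word star S i x \<Longrightarrow> 1 \<le> i \<and> x \<in> filt S i"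
proof (induction rule: word.induct)
  case (word_unity u)
  then show ?case using no_unity by blast
next
  case (word_gen a)
  then show ?case using span_letters_subset_filt[of S] span_base[of a "insert e S"] by auto
next
  case (word_mult i a j b)
  then show ?case by (simp add: star_in_filt)
qed

lemma L_subset_filt: "L S k \<subseteq> filt S k"
  unfolding L_upto_def
proof (rule span_minimal)
  show "{a. \<exists>i\<le>k. word star S i a} \<subseteq> filt S k"
    using word_star filt_mono[of _ k S] by blast
qed simp

lemma star_in_L:
  assumes "x \<in> L S i" "y \<in> L S j"
  shows "star x y \<in> L S (i + j)"
proof (rule star.mult_in_subspace[OF subspace_L_upto _ assms[unfolded L_upto_def]])
  fix x y assume "x \<in> {a. \<exists>k\<le>i. word star S k a}" "y \<in> {a. \<exists>k\<le>j. word star S k a}"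
  then obtain k l where kl: "k \<le> i" "word star S k x" "l \<le> j" "word star S l y" by blast
  then have "word star S (k + l) (star x y)" using word_star by (intro word_mult) blast+
  with kl(1,3) have "star x y \<in> {a. \<exists>m\<le>i + j. word star S m a}"
    by (intro CollectI exI[of _ "k + l"]) simp
  then show "star x y \<in> L S (i + j)" unfolding L_upto_def by (rule span_base)
qed

lemma letter_in_L:
  assumes "a \<in> S"
  shows "a \<in> L S (Suc k)"
proof -
  have "a \<in> {a. \<exists>m\<le>Suc k. word star S m a}"
    using word_gen[OF assms, of star] by (intro CollectI exI[of _ 1]) simp
  then show ?thesis unfolding L_upto_def by (rule span_base)
qed

lemma L_one: "L S (Suc 0) = span S"
proof
  have "x \<in> S" if "word star S i x" "i \<le> Suc 0" for i x
    using that(1)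
  proof cases
    case (word_mult k a l b)
    then show ?thesis using that(2) by simp
  qed (use no_unity in auto)
  then have "{a. \<exists>i\<le>Suc 0. word star S i a} \<subseteq> S" by blast
  then show "L S (Suc 0) \<subseteq> span S" unfolding L_upto_def by (rule span_mono)
  have "S \<subseteq> L S (Suc 0)" using letter_in_L by blast
  then show "span S \<subseteq> L S (Suc 0)" by (rule span_minimal) simp
qed

lemma L_zero: "L S 0 = {0}"
proof -
  have "{a. \<exists>i\<le>0. word star S i a} = {}" using word_star by fastforce
  then show ?thesis by (simp add: L_upto_def)
qed

text \<open>By \<open>mult_in_span_star\<close> each product with a letter is recovered from the
  star product of the same factors, up to these factors and \<open>e\<close>. So the unit is all
  that \<open>L S k\<close> can lack.\<close>

lemma filt_subset_span_L: "filt S k \<subseteq> span (insert e (L S k))"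
proof (induction k)
  case 0
  then show ?case by (auto intro: subsetD[OF span_mono])
next
  case (Suc k)
  let ?U = "span (insert e (L S (Suc k)))"
  have LU: "x \<in> ?U" if "x \<in> L S (Suc k)" for x using that by (auto intro: span_base)
  have up: "L S k \<subseteq> L S (Suc k)" by (rule L_upto_mono) simp
  have "a \<cdot> x \<in> ?U" if a: "a \<in> S" and x: "x \<in> filt S k" for a x
  proof (rule mult_left_in_subspace[OF subspace_span])
    show "x \<in> span (insert e (L S k))" using x Suc by blast
    fix y assume y: "y \<in> insert e (L S k)"
    show "a \<cdot> y \<in> ?U"
    proof (cases "y = e")
      case True
      then show ?thesis using LU[OF letter_in_L[OF a]] by simp
    next
      case False
      with y have y: "y \<in> L S k" by simp
      have "star a y \<in> L S (Suc k)" using star_in_L[OF letter_in_L[OF a, of 0] y] by simp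
      then have "{e, a, y, star a y} \<subseteq> insert e (L S (Suc k))"
        using y up letter_in_L[OF a] by blast
      then show ?thesis using mult_in_span_star[of a y] span_mono by blast
    qed
  qed
  moreover have "filt S k \<subseteq> ?U" using Suc span_mono[OF insert_mono[OF up]] by blast
  ultimately show ?case unfolding filt.simps by (intro span_minimal) auto
qed

lemma L_subset_span_of_closed:
  assumes "\<And>x y. x \<in> S \<Longrightarrow> y \<in> S \<Longrightarrow> star x y \<in> span S"
  shows "L S k \<subseteq> span S"
proof -
  have "x \<in> span S" if "word star S i x" for i x
    using that
  proof (induction rule: word.induct)
    case (word_mult i a j b)
    then show ?case using star.mult_in_subspace[OF subspace_span assms] by blast
  qed (use no_unity in \<open>auto intro: span_base\<close>)
  then show ?thesis unfolding L_upto_def by (intro span_minimal) auto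
qed

text \<open>By \<open>star_swap\<close>, \<open>polar Q x y\<close> is the coefficient of
  \<open>e\<close> in an element of \<open>L S m\<close>, modulo \<open>x\<close> and
  \<open>y\<close>, which also lie there. A nonzero coefficient would put \<open>e\<close> into
  \<open>L S m\<close>.\<close>

lemma polar_Q_eq_0:
  assumes "e \<notin> L S m" "i + j \<le> m" "x \<in> L S i" "y \<in> L S j"
  shows "polar Q x y = 0"
proof (rule ccontr)
  assume ne: "polar Q x y \<noteq> 0"
  have mono: "k \<le> m \<Longrightarrow> L S k \<subseteq> L S m" for k by (rule L_upto_mono)
  have "star x y \<in> L S m" using star_in_L[OF assms(3,4)] mono[OF assms(2)] by blast
  moreover have "star y x \<in> L S m" using star_in_L[OF assms(4,3)] mono[of "j + i"] assms(2) by auto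
  moreover have "span {x, y} \<subseteq> L S m"
    using assms(2-4) mono[of i] mono[of j] by (intro span_minimal) auto
  then have "star x y + star y x - polar Q x y *\<^sub>s e \<in> L S m" using star_swap by blast
  ultimately show False
    using unit_in_subspace[OF subspace_L_upto subspace_add[OF subspace_L_upto]] ne assms(1) by blast
qed

lemma Q_eq_0:
  assumes "e \<notin> L S m" "i + i \<le> m" "x \<in> L S i"
  shows "Q x = 0"
proof (rule ccontr)
  assume ne: "Q x \<noteq> 0"
  have mono: "k \<le> m \<Longrightarrow> L S k \<subseteq> L S m" for k by (rule L_upto_mono)
  have "star x x \<in> L S m" using star_in_L[OF assms(3,3)] mono[OF assms(2)] by blast
  moreover have "span {x} \<subseteq> L S m"
    using assms(2-3) mono[of i] by (intro span_minimal) auto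
  then have "star x x - Q x *\<^sub>s e \<in> L S m" using star_self by blast
  ultimately show False using unit_in_subspace[OF subspace_L_upto] ne assms(1) by blast
qed

lemma polar_Q_commute: "polar Q x y = polar Q y x"
  by (simp add: polar_def add.commute)

text \<open>For type IV in characteristic 3 the form \<open>polar Q\<close> is degenerate, with
  radical the line of \<open>e\<close>. The premise that \<open>e\<close> is not in \<open>W\<close>
  keeps this radical away from \<open>W\<close>.\<close>

lemma dim_orthogonal_Q_le:
  assumes "subspace W" "subspace U" "e \<notin> W" "\<And>w u. w \<in> W \<Longrightarrow> u \<in> U \<Longrightarrow> polar Q w u = 0"
  shows "dim W + dim U \<le> dim UNIV"
proof -
  obtain as where as: "gen as = UNIV" using hurwitz by blast
  show ?thesis
  proof (rule dim_orthogonal_le[OF finite_subwords as _ linear_polar_Q assms(1,2,4)])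
    show "Vector_Spaces.linear (*\<^sub>s) (*) (\<lambda>x. polar Q x y)" for y
      using linear_polar_Q[of y] by (simp add: polar_Q_commute[of _ y])
    fix w assume w: "w \<in> W" "\<And>y. polar Q w y = 0"
    then obtain r where r: "w = r *\<^sub>s e" using polar_Q_radical by (auto simp: span_singleton)
    show "w = 0"
    proof (rule ccontr)
      assume "w \<noteq> 0"
      then have "r \<noteq> 0" using r by auto
      moreover have "inverse r *\<^sub>s w \<in> W" using assms(1) w(1) by (rule subspace_scale)
      ultimately show False using assms(3) r by simp
    qed
  qed
qed

lemma star_in_L_two: "x \<in> S \<Longrightarrow> y \<in> S \<Longrightarrow> star x y \<in> L S 2"
  using star_in_L[OF letter_in_L letter_in_L, of x S y 0 0] by (simp add: numeral_2_eq_2)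

section \<open>Upper bounds for a generating set in dimensions 2, 4 and 8\<close>

context
  fixes S :: "'a set" and m :: nat
  assumes gen_S: "generating scale star S" and dim: "dim UNIV = 2 ^ m"
begin

lemma filt_generating: "filt S m = UNIV"
proof -
  obtain as where as: "gen as = UNIV" using hurwitz by blast
  have "(\<Union>k. L S k) = UNIV" using gen_S by (simp add: generating_def L_infty_def)
  moreover have "(\<Union>k. L S k) \<subseteq> (\<Union>k. filt S k)" by (intro UN_mono subset_refl L_subset_filt)
  ultimately have "(\<Union>k. filt S k) = UNIV" by (simp only: UNIV_I top.extremum_unique)
  then show ?thesis by (rule filt_full[OF finite_subwords as dim])
qed

lemma span_L_generating: "m \<le> k \<Longrightarrow> span (insert e (L S k)) = UNIV"
proof -
  assume "m \<le> k"
  then have "UNIV \<subseteq> filt S k" using filt_mono[of m k S] by (simp only: filt_generating)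
  also note filt_subset_span_L[of S k]
  finally show ?thesis by (rule top.extremum_uniqueI)
qed

lemma L_full_iff:
  assumes "m \<le> k"
  shows "L S k = UNIV \<longleftrightarrow> e \<in> L S k"
proof
  assume "e \<in> L S k"
  then have "span (insert e (L S k)) = L S k" by (simp add: insert_absorb)
  then show "L S k = UNIV" using span_L_generating[OF assms] by simp
qed simp

lemma not_closed:
  assumes "e \<notin> span S"
  shows "\<exists>x\<in>S. \<exists>y\<in>S. star x y \<notin> span S"
proof (rule ccontr)
  assume "\<not> ?thesis"
  then have "L S k \<subseteq> span S" for k by (intro L_subset_span_of_closed) blast
  then have "(\<Union>k. L S k) \<subseteq> span S" by (rule UN_least)
  moreover have "(\<Union>k. L S k) = UNIV" using gen_S by (simp add: generating_def L_infty_def)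
  ultimately show False using assms by auto
qed

lemma unit_notin_span: "e \<notin> L S k \<Longrightarrow> 1 \<le> k \<Longrightarrow> e \<notin> span S"
  using L_upto_mono[of 1 k star S] L_one[of S] by auto

lemma L_two_neq:
  assumes "e \<notin> span S"
  shows "L S 2 \<noteq> span S"
  using not_closed[OF assms] star_in_L_two by metis

lemma letters_list:
  "\<exists>as. span (set as) = span S \<and> length as = dim (span S) \<and> set as \<subseteq> span S"
proof -
  obtain B where B: "B \<subseteq> span S" "independent B" "span S \<subseteq> span B" "card B = dim (span S)"
    by (rule basis_exists)
  obtain as' where "gen as' = UNIV" using hurwitz by blast
  then have "finite B" using independent_span_bound[OF finite_subwords B(2), of "length as'" as'] by simp
  then obtain as where "set as = B" "distinct as" using finite_distinct_list by blast
  moreover have "span B = span S"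
    using B(3) span_minimal[OF B(1) subspace_span] by (rule equalityI[rotated])
  ultimately show ?thesis using B(1,4) distinct_card by (intro exI[of _ as]) force
qed

lemma full_subwords:
  assumes "span (set as) = span S"
  shows "span (subwords m as) = UNIV"
proof -
  have "S \<subseteq> span (set as)" using assms span_superset by blast
  also have "\<dots> \<subseteq> span (insert e (set as))" by (rule span_mono) blast
  finally have "S \<subseteq> span (insert e (set as))" .
  from filt_subset_span_subwords[OF this, of m] show ?thesis unfolding filt_generating by blast
qed

lemma length_letters:
  assumes "span (set as) = span S"
  shows "m \<le> length as"
proof (rule ccontr)
  assume "\<not> m \<le> length as"
  then have "subwords m as = subwords (length as) as" by (intro subwords_saturated) simp
  moreover have "dim UNIV \<le> card (subwords m as)"
    using dim_le_card[OF _ finite_subwords] full_subwords[OF assms] by simp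
  moreover have "card (subwords (length as) as) \<le> 2 ^ length as"
    using card_subwords_le[of "length as" as] by (simp add: choose_row_sum)
  ultimately have "(2::nat) ^ m \<le> 2 ^ length as" using dim by (metis le_trans)
  then show False using \<open>\<not> m \<le> length as\<close> by simp
qed

text \<open>The line of \<open>e\<close> and \<open>span S\<close> already fill the plane, so
  anything new in \<open>L S 2\<close> would bring \<open>e\<close> along. Without \<open>e\<close>,
  \<open>L S 2 = span S\<close> would be closed under \<open>star\<close>, and \<open>S\<close>
  could not generate.\<close>

lemma L_generating_1:
  assumes "m = 1"
  shows "L S 2 = UNIV"
proof (rule ccontr)
  assume "L S 2 \<noteq> UNIV"
  then have e: "e \<notin> L S 2" using L_full_iff[of 2] assms by simp
  have "L S 2 \<subseteq> span S"
  proof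
    fix x assume x: "x \<in> L S 2"
    have "x \<in> span (insert e (span S))" using span_L_generating[of 1] assms by (simp add: L_one)
    then obtain r where r: "x - r *\<^sub>s e \<in> span S" by (auto simp: span_insert span_span)
    then have "x - r *\<^sub>s e \<in> L S 2" using L_upto_mono[of 1 2 star S] by (auto simp: L_one)
    then have "r = 0" using unit_in_subspace[OF subspace_L_upto x] e by blast
    then show "x \<in> span S" using r by simp
  qed
  then have "L S 2 = span S" using L_upto_mono[of 1 2 star S] by (auto simp: L_one)
  then show False using L_two_neq unit_notin_span[OF e] by simp
qed

text \<open>Orthogonality of \<open>span S\<close> to itself and \<open>length_letters\<close> leave
  exactly two letters \<open>a\<close>, \<open>b\<close>. Once \<open>span S\<close> is also
  orthogonal to \<open>star a b\<close>, the count reads 2 + 3 <= 4.\<close>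

lemma L_generating_2:
  assumes "m = 2"
  shows "L S 2 = UNIV"
proof (rule ccontr)
  assume "L S 2 \<noteq> UNIV"
  then have e: "e \<notin> L S 2" using L_full_iff[of 2] assms by simp
  have W: "span S \<subseteq> L S 2" using L_upto_mono[of 1 2 star S] by (simp add: L_one)
  have pQ: "polar Q x y = 0" if "x \<in> span S" "y \<in> span S" for x y
    using polar_Q_eq_0[OF e, of 1 1 x y] that by (simp add: L_one)
  have Q0: "Q x = 0" if "x \<in> span S" for x
    using Q_eq_0[OF e, of 1 x] that by (simp add: L_one)
  obtain as where as: "span (set as) = span S" "length as = dim (span S)" "set as \<subseteq> span S"
    using letters_list by blast
  have eS: "e \<notin> span S" using W e by blast
  then have "dim (span S) + dim (span S) \<le> 4"
    using dim_orthogonal_Q_le[OF subspace_span subspace_span eS pQ] dim assms by simp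
  then have "length as = 2" using length_letters[OF as(1)] assms as(2) by simp
  then obtain a b where ab: "as = [a, b]" by (auto simp: length_Suc_conv numeral_2_eq_2)
  then have a: "a \<in> span S" and b: "b \<in> span S" using as(3) by auto
  let ?U = "span {a, b, star a b}"
  have "star a b \<in> L S 2"
    using star_in_L[of a S 1 b 1] a b by (simp add: L_one numeral_2_eq_2)
  then have U: "?U \<subseteq> L S 2" using a b W by (intro span_minimal) auto
  \<comment> \<open>The products of \<open>x\<close> with \<open>star x y\<close> have length 3 and
    are not in \<open>L S 2\<close> for free. As \<open>Q x\<close> and \<open>polar Q x y\<close>
    vanish, \<open>star_star_left\<close> and \<open>star_star_right\<close> bring them back into
    \<open>L S 2\<close>, and the usual extraction of \<open>e\<close> applies.\<close>
  have orth: "polar Q x (star x y) = 0" if "x \<in> span S" "y \<in> span S" and U': "span {x, y, star x y} \<subseteq> L S 2" for x y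
  proof (rule ccontr)
    let ?z = "star x y"
    assume ne: "polar Q x ?z \<noteq> 0"
    have "star x ?z \<in> L S 2" "star ?z x \<in> L S 2"
      using star_star_left[OF Q0[OF that(1)] pQ[OF that(1,2)]]
        star_star_right[OF Q0[OF that(1)] pQ[OF that(1,2)]] U' by blast+
    moreover have "star x ?z + star ?z x - polar Q x ?z *\<^sub>s e \<in> L S 2"
      using subsetD[OF subset_trans[OF span_mono U'] star_swap[of x ?z]] by blast
    ultimately show False
      using unit_in_subspace[OF subspace_L_upto subspace_add[OF subspace_L_upto]] ne e by blast
  qed
  interpret Qa: Vector_Spaces.linear scale "(*)" "polar Q a" by (rule linear_polar_Q)
  interpret Qb: Vector_Spaces.linear scale "(*)" "polar Q b" by (rule linear_polar_Q)
  have ba: "star b a + star a b \<in> span {b, a}" using star_swap[of b a] pQ[OF b a] by simp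
  have qa: "polar Q a u = 0" if "u \<in> ?U" for u
  proof (rule Qa.eq_0_on_span[OF _ that])
    fix x assume "x \<in> {a, b, star a b}"
    then show "polar Q a x = 0" using pQ a b orth[OF a b U] by auto
  qed
  \<comment> \<open>Here \<open>orth\<close> speaks of \<open>star b a\<close>; by \<open>ba\<close>
    it differs from \<open>- star a b\<close> only by letters, which are orthogonal to
    \<open>b\<close>.\<close>
  have qb: "polar Q b u = 0" if "u \<in> ?U" for u
  proof (rule Qb.eq_0_on_span[OF _ that])
    have "\<And>x. x \<in> {b, a} \<Longrightarrow> polar Q b x = 0" using pQ a b by blast
    then have "polar Q b (star b a + star a b) = 0" using ba by (rule Qb.eq_0_on_span)
    moreover have "span {b, a, star b a} \<subseteq> L S 2"
    proof (rule span_minimal)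
      have "star b a \<in> L S 2"
        using star_in_L[of b S 1 a 1] a b by (simp add: L_one numeral_2_eq_2)
      then show "{b, a, star b a} \<subseteq> L S 2" using a b W by blast
    qed simp
    then have "polar Q b (star b a) = 0" using orth[OF b a] by blast
    ultimately have "polar Q b (star a b) = 0" by (simp add: Qb.add)
    then show "polar Q b x = 0" if "x \<in> {a, b, star a b}" for x using pQ a b that by auto
  qed
  have "polar Q w u = 0" if "w \<in> span S" "u \<in> ?U" for w u
  proof -
    interpret Qu: Vector_Spaces.linear scale "(*)" "polar Q u" by (rule linear_polar_Q)
    have w: "w \<in> span {a, b}" using that(1) as(1) ab by simp
    have "\<And>x. x \<in> {a, b} \<Longrightarrow> polar Q u x = 0"
      using qa[OF that(2)] qb[OF that(2)] polar_Q_commute[of u] by auto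
    then have "polar Q u w = 0" using w by (rule Qu.eq_0_on_span)
    then show ?thesis by (simp add: polar_Q_commute)
  qed
  then have "dim (span S) + dim ?U \<le> 4"
    using dim_orthogonal_Q_le[OF subspace_span subspace_span eS] dim assms by simp
  moreover have "dim UNIV \<le> Suc (dim {a, b, star a b})"
  proof (rule dim_UNIV_le_Suc[of e])
    have "subwords 2 as = {e, b, a, a \<cdot> b}" by (auto simp: ab numeral_2_eq_2)
    also have "\<dots> \<subseteq> span (insert e {a, b, star a b})"
      using mult_in_span_star[of a b] by (simp add: span_base)
    finally have "span (subwords 2 as) \<subseteq> span (insert e {a, b, star a b})"
      by (rule span_minimal) simp
    then show "span (insert e {a, b, star a b}) = UNIV"
      using full_subwords[OF as(1)] assms by auto
  qed
  ultimately show False using dim assms as(2) \<open>length as = 2\<close> by simp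
qed

text \<open>The bound \<open>le8\<close> leaves no choice but three letters: with four or more,
  \<open>L S 2\<close> would be no larger than \<open>span S\<close>, so \<open>span S\<close> would
  be closed under \<open>star\<close>. With three, \<open>dim (L S 2)\<close> is at most 5, too
  small for the subwords to fill dimension 8.\<close>

lemma L_generating_3:
  assumes "m = 3"
  shows "L S 3 = UNIV"
proof (rule ccontr)
  assume "L S 3 \<noteq> UNIV"
  then have e: "e \<notin> L S 3" using L_full_iff[of 3] assms by simp
  have W: "span S \<subseteq> L S 2" using L_upto_mono[of 1 2 star S] by (simp add: L_one)
  have "L S 2 \<subseteq> L S 3" by (rule L_upto_mono) simp
  then have eS: "e \<notin> span S" using W e by blast
  have pQ: "polar Q x y = 0" if "x \<in> span S" "y \<in> L S 2" for x y
    using polar_Q_eq_0[OF e, of 1 2 x y] that by (simp add: L_one)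
  have le8: "dim (span S) + dim (L S 2) \<le> 8"
    using dim_orthogonal_Q_le[OF subspace_span subspace_L_upto eS pQ] dim assms by simp
  obtain as where as: "span (set as) = span S" "length as = dim (span S)" "set as \<subseteq> span S"
    using letters_list by blast
  obtain B where B: "B \<subseteq> UNIV" "independent B" "UNIV \<subseteq> span B" "card B = dim UNIV"
    by (rule basis_exists)
  obtain as' where "gen as' = UNIV" using hurwitz by blast
  then have "finite B" using independent_span_bound[OF finite_subwords B(2), of "length as'" as'] by simp
  then interpret fin: finite_dimensional_vector_space scale B
    using B by unfold_locales auto
  have "length as = 3"
  proof (rule ccontr)
    assume "length as \<noteq> 3"
    then have "dim (L S 2) \<le> dim (span S)"
      using le8 length_letters[OF as(1)] assms as(2) by simp
    then have "span S = L S 2" using W by (intro fin.subspace_dim_equal) auto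
    then show False using L_two_neq[OF eS] by simp
  qed
  then obtain a b c where abc: "as = [a, b, c]" by (auto simp: length_Suc_conv numeral_3_eq_3)
  \<comment> \<open>The only subword with all three letters. The others lie in
    \<open>filt S 2\<close>, so \<open>p\<close>, \<open>e\<close> and \<open>L S 2\<close> span the
    algebra and \<open>dim (L S 2)\<close> would have to be at least 6.\<close>
  define p where "p = a \<cdot> (b \<cdot> (c \<cdot> e))"
  have "span (subwords 2 as) \<subseteq> filt S 2"
    using as(3) span_mono[of S "insert e S"] by (intro span_subwords_subset_filt) blast
  then have "subwords 2 as \<subseteq> span (insert e (L S 2))"
    using span_superset filt_subset_span_L by blast
  moreover have "subwords 3 as \<subseteq> insert p (subwords 2 as)"
    by (auto simp: abc p_def numeral_3_eq_3 numeral_2_eq_2)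
  ultimately have "subwords 3 as \<subseteq> span (insert p (insert e (L S 2)))"
    using span_mono[of "insert e (L S 2)" "insert p (insert e (L S 2))"]
      span_superset[of "insert p (insert e (L S 2))"] by blast
  then have "span (subwords 3 as) \<subseteq> span (insert p (insert e (L S 2)))"
    by (rule span_minimal) simp
  then have "span (insert p (insert e (L S 2))) = UNIV"
    using full_subwords[OF as(1)] assms by auto
  then have "dim UNIV \<le> Suc (dim (insert e (L S 2)))" by (rule dim_UNIV_le_Suc)
  also have "dim (insert e (L S 2)) \<le> Suc (dim (L S 2))" by (simp add: fin.dim_insert)
  finally show False using le8 dim assms as(2) \<open>length as = 3\<close> by simp
qed

end

section \<open>Exact lengths for types II and IV\<close>

lemma alg_length_star_ge_2:
  assumes "dim UNIV = 2 ^ m" "2 \<le> m"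
  shows "alg_length scale star = m"
proof -
  obtain as where as: "length as \<le> 3" "gen as = UNIV" "dim UNIV = 2 ^ length as"
    using hurwitz by blast
  have m: "length as = m" using as(3) assms by simp
  then have m23: "m = 2 \<or> m = 3" using as(1) assms(2) by auto
  \<comment> \<open>With \<open>e\<close> among the generators, full filtration means full
    \<open>L\<close>. The lower bound is unharmed, because \<open>filt\<close> contains
    \<open>e\<close> from the start.\<close>
  let ?S = "insert e (set as)"
  have eL: "e \<in> L ?S m" using letter_in_L[of e ?S "m - 1"] assms(2) by simp
  have "filt (set as) m \<subseteq> filt ?S m"
    using as(2) span_subwords_subset_filt[of as ?S m] span_superset[of "insert e ?S"]
    by (simp add: filt_eq_span_subwords)
  then have "filt ?S m = UNIV" using as(2) by (auto simp: filt_eq_span_subwords m)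
  moreover have "span (insert e (L ?S m)) = L ?S m" using eL by (simp add: insert_absorb)
  ultimately have "L ?S m = UNIV" using filt_subset_span_L[of ?S m] by blast
  then have "generating scale star ?S"
    using L_upto_subset_L_infty[of star ?S m] by (auto simp: generating_def)
  moreover have "L S m = UNIV" if "generating scale star S" for S
    using L_generating_2[OF that assms(1)] L_generating_3[OF that assms(1)] m23 by blast
  moreover have "L ?S k \<noteq> UNIV" if "k < m" for k
    using filt_proper[OF as(3), of k ?S] that m L_subset_filt[of ?S k] span_superset[of ?S] by auto
  ultimately show ?thesis by (intro alg_length_eqI)
qed

text \<open>If \<open>Q x \<noteq> 0\<close> for some \<open>x\<close> off the line of
  \<open>e\<close>, the set \<open>{x}\<close> generates in two steps, as \<open>star x x\<close>
  yields \<open>e\<close>. If there is no such \<open>x\<close>, a set whose span lacks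
  \<open>e\<close> spans at most a line closed under \<open>star\<close>, so a generating set must
  span the plane at once.\<close>

lemma alg_length_star_dim_2:
  assumes "dim UNIV = 2"
  shows "alg_length scale star = (if \<exists>x. x \<notin> span {e} \<and> Q x \<noteq> 0 then 2 else 1)"
proof -
  have dim: "dim UNIV = 2 ^ 1" using assms by simp
  have small: "span {x} \<noteq> UNIV" for x
    using dim_le_card[of UNIV "{x}"] assms by auto
  have L0: "L S 0 \<noteq> UNIV" for S using small[of 0] by (simp add: L_zero)
  show ?thesis
  proof (cases "\<exists>x. x \<notin> span {e} \<and> Q x \<noteq> 0")
    case True
    then obtain x where x: "x \<notin> span {e}" "Q x \<noteq> 0" by blast
    have "x \<in> L {x} 2" using letter_in_L[of x "{x}" 1] by (simp add: numeral_2_eq_2)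
    have "star x x \<in> L {x} 2"
      using star_in_L[OF letter_in_L letter_in_L, of x "{x}" x 0 0] by (simp add: numeral_2_eq_2)
    moreover have "span {x} \<subseteq> L {x} 2" using \<open>x \<in> L {x} 2\<close> by (intro span_minimal) auto
    then have "star x x - Q x *\<^sub>s e \<in> L {x} 2" using star_self by blast
    ultimately have e: "e \<in> L {x} 2" using unit_in_subspace[OF subspace_L_upto] x(2) by blast
    have ind: "independent {x, e}" using x unity_nonzero by (simp add: independent_insertI)
    have "x \<noteq> e" using x(1) span_base[of e "{e}"] by auto
    have "UNIV \<subseteq> span {x, e}"
    proof
      fix y
      show "y \<in> span {x, e}"
      proof (rule ccontr)
        assume "y \<notin> span {x, e}"
        then have ind3: "independent {y, x, e}" "y \<notin> {x, e}"
          using ind by (auto simp: independent_insertI span_base)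
        obtain B where B: "B \<subseteq> UNIV" "independent B" "UNIV \<subseteq> span B" "card B = dim UNIV"
          by (rule basis_exists)
        have "finite B" using B(4) assms card.infinite by fastforce
        from independent_span_bound[OF this ind3(1)] have "card {y, x, e} \<le> 2" using B assms by auto
        then show False using ind3(2) \<open>x \<noteq> e\<close> by auto
      qed
    qed
    moreover have "span {x, e} \<subseteq> L {x} 2" using \<open>x \<in> L {x} 2\<close> e by (intro span_minimal) auto
    ultimately have "L {x} 2 = UNIV" by blast
    then have gen: "generating scale star {x}"
      using L_upto_subset_L_infty[of star "{x}" 2] by (auto simp: generating_def)
    have "alg_length scale star = 2"
    proof (rule alg_length_eqI[OF _ gen])
      show "L S 2 = UNIV" if "generating scale star S" for S
        using L_generating_1[OF that dim] by simp
      show "L {x} k \<noteq> UNIV" if "k < 2" for k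
        using that L0[of "{x}"] small[of x] L_one[of "{x}"] by (cases k) (auto simp: numeral_2_eq_2)
    qed
    then show ?thesis using True by simp
  next
    case False
    have upper: "L S 1 = UNIV" if S: "generating scale star S" for S
    proof (rule ccontr)
      assume "L S 1 \<noteq> UNIV"
      then have eS: "e \<notin> span S" using L_full_iff[OF S dim, of 1] by (simp add: L_one)
      obtain B where B: "B \<subseteq> span S" "independent B" "span S \<subseteq> span B" "card B = dim (span S)"
        by (rule basis_exists)
      have "span B = span S" using B(1,3) span_minimal[OF B(1)] by auto
      then have ind: "independent (insert e B)" "e \<notin> B"
        using eS B(2) by (auto simp: independent_insertI intro: span_base)
      obtain G where G: "G \<subseteq> UNIV" "independent G" "UNIV \<subseteq> span G" "card G = dim UNIV"
        by (rule basis_exists)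
      have "finite G" using G(4) assms card.infinite by fastforce
      moreover have "insert e B \<subseteq> span G" using G(3) by blast
      ultimately have "finite (insert e B) \<and> card (insert e B) \<le> card G"
        using ind(1) by (intro independent_span_bound)
      then have "finite B" "card B \<le> 1" using G(4) assms ind(2) by auto
      then obtain a where a: "B \<subseteq> {a}" "a \<in> span S"
      proof (cases "B = {}")
        case True
        then show ?thesis using that[of 0] by (simp add: span_zero)
      next
        case False
        then have "card B = 1" using \<open>finite B\<close> \<open>card B \<le> 1\<close> by (simp add: card_gt_0_iff le_antisym Suc_leI)
        then obtain a where "B = {a}" by (rule card_1_singletonE)
        then show ?thesis using that[of a] B(1) by simp
      qed
      have span: "span S = span {a}"
      proof
        show "span S \<subseteq> span {a}" using B(3) span_mono[OF a(1)] by blast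
        show "span {a} \<subseteq> span S" using a(2) by (intro span_minimal) auto
      qed
      have "star a a \<in> span {a}"
      proof (cases "a = 0")
        case True
        then show ?thesis by (simp add: span_zero)
      next
        case nz: False
        have "a \<notin> span {e}"
        proof
          assume "a \<in> span {e}"
          then obtain r where r: "a = r *\<^sub>s e" by (auto simp: span_singleton)
          then have "e = inverse r *\<^sub>s a" using nz by auto
          then show False using eS a(2) span_scale by metis
        qed
        then have "Q a = 0" using False by blast
        then show ?thesis using star_self[of a] by simp
      qed
      then have "star x y \<in> span S" if "x \<in> S" "y \<in> S" for x y
        using star.mult_in_subspace[of "span {a}" "{a}" "{a}" x y] that span_base[of _ S]
        unfolding span by blast
      then show False using not_closed[OF S dim eS] by blast
    qed
    \<comment> \<open>Any generating set will do: there is no unity for \<open>star\<close>, so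
      \<open>L\<close> starts at \<open>{0}\<close> and length 0 is impossible.\<close>
    have gen: "generating scale star UNIV"
      using L_upto_subset_L_infty[of star UNIV "Suc 0"] by (auto simp: generating_def L_one)
    have "alg_length scale star = 1"
      by (rule alg_length_eqI[OF upper gen]) (use L0 in simp_all)
    then show ?thesis using False by simp
  qed
qed

end

section \<open>The four types\<close>

context hurwitz_algebra
begin

lemma conj_mult_in_filt:
  "x \<in> filt S i \<Longrightarrow> y \<in> filt S j \<Longrightarrow> x\<^bsup>c\<^esup> \<cdot> y \<in> filt S (i + j)"
  "x \<in> filt S i \<Longrightarrow> y \<in> filt S j \<Longrightarrow> x\<^bsup>c\<^esup> \<cdot> y\<^bsup>c\<^esup> \<in> filt S (i + j)"
  by (simp_all add: mult_in_filt conj_in_filt)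

lemma nonassoc_algebra_conj:
  "nonassoc_algebra scale (\<lambda>x y. x\<^bsup>c\<^esup> \<cdot> y)"
  "nonassoc_algebra scale (\<lambda>x y. x\<^bsup>c\<^esup> \<cdot> y\<^bsup>c\<^esup>)"
  by (intro nonassoc_algebra.intro nonassoc_algebra_axioms.intro vector_space_axioms;
      simp add: Vector_Spaces.linear_iff vector_space_axioms conj_add conj_scale mult_simps)+

lemma span_three: "p *\<^sub>s x + q *\<^sub>s y + r *\<^sub>s z \<in> span {x, y, z}"
  by (intro span_add span_scale) (simp_all add: span_base)

lemma conj_swap: "x\<^bsup>c\<^esup> \<cdot> y + y\<^bsup>c\<^esup> \<cdot> x = \<langle>x,y\<rangle> *\<^sub>s e"
  using anticommutator[of x y] by (simp add: conj_eq mult_simps polar_commute)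

text \<open>Here \<open>Q = n\<close>, because the conjugate of \<open>x\<close> times
  \<open>x\<close> is \<open>n x *\<^sub>s e\<close>. A unity of \<open>star\<close> would have to
  be \<open>e\<close>, which makes conjugation trivial.\<close>

lemma twisted_TypeII:
  assumes "2 \<le> dim UNIV"
  shows "twisted_hurwitz_algebra scale mult n e (\<lambda>x y. x\<^bsup>c\<^esup> \<cdot> y) n"
proof (intro twisted_hurwitz_algebra.intro twisted_hurwitz_algebra_axioms.intro)
  fix x y u :: 'a
  have "x \<cdot> y = 0 *\<^sub>s x + trace x *\<^sub>s y + (- 1) *\<^sub>s (x\<^bsup>c\<^esup> \<cdot> y)"
    by (simp add: conj_eq mult_simps)
  then have "x \<cdot> y \<in> span {x, y, x\<^bsup>c\<^esup> \<cdot> y}" using span_three by metis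
  then show "x \<cdot> y \<in> span {e, x, y, x\<^bsup>c\<^esup> \<cdot> y}"
    using span_mono[of "{x, y, x\<^bsup>c\<^esup> \<cdot> y}" "{e, x, y, x\<^bsup>c\<^esup> \<cdot> y}"] by blast
  show "\<not> is_unity (\<lambda>x y. x\<^bsup>c\<^esup> \<cdot> y) u"
  proof
    assume u: "is_unity (\<lambda>x y. x\<^bsup>c\<^esup> \<cdot> y) u"
    then have "e\<^bsup>c\<^esup> \<cdot> u = e" unfolding is_unity_def by blast
    then have "u = e" by simp
    then have "x\<^bsup>c\<^esup> = x" for x using u by (simp add: is_unity_def)
    then show False using conj_not_identity[OF assms] by blast
  qed
  show "x\<^bsup>c\<^esup> \<cdot> x - n x *\<^sub>s e \<in> span {x}" by (simp add: mult_conj_self span_zero)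
  show "x\<^bsup>c\<^esup> \<cdot> y + y\<^bsup>c\<^esup> \<cdot> x - \<langle>x,y\<rangle> *\<^sub>s e \<in> span {x, y}" by (simp add: conj_swap span_zero)
  show "x \<in> span {e}" if "\<And>y. \<langle>x,y\<rangle> = 0"
    using polar_nondegenerate[OF that] by (simp add: span_zero)
  assume Q: "n x = 0" "\<langle>x,y\<rangle> = 0"
  have "x\<^bsup>c\<^esup> \<cdot> (x\<^bsup>c\<^esup> \<cdot> y) = 0 *\<^sub>s x + 0 *\<^sub>s y + trace x *\<^sub>s (x\<^bsup>c\<^esup> \<cdot> y)"
    using left_square[of "x\<^bsup>c\<^esup>" y] Q by simp
  then show "x\<^bsup>c\<^esup> \<cdot> (x\<^bsup>c\<^esup> \<cdot> y) \<in> span {x, y, x\<^bsup>c\<^esup> \<cdot> y}" using span_three by metis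
  have "y\<^bsup>c\<^esup> \<cdot> x = - (x\<^bsup>c\<^esup> \<cdot> y)" using conj_swap[of x y] Q by (simp add: add_eq_0_iff)
  then have "(x\<^bsup>c\<^esup> \<cdot> y)\<^bsup>c\<^esup> \<cdot> x = 0 *\<^sub>s x + 0 *\<^sub>s y + (- trace x) *\<^sub>s (x\<^bsup>c\<^esup> \<cdot> y)"
    using right_square[of "y\<^bsup>c\<^esup>" x] Q by (simp add: conj_mult)
  then show "(x\<^bsup>c\<^esup> \<cdot> y)\<^bsup>c\<^esup> \<cdot> x \<in> span {x, y, x\<^bsup>c\<^esup> \<cdot> y}" using span_three by metis
qed (rule assms hurwitz_algebra_axioms nonassoc_algebra_conj conj_mult_in_filt linear_polar
    | assumption)+

lemma polar_trace_norm: "polar (\<lambda>x. (trace x)\<^sup>2 - n x) x y = 2 * trace x * trace y - \<langle>x,y\<rangle>"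
  unfolding polar_def[of "\<lambda>x. (trace x)\<^sup>2 - n x"]
  by (simp add: norm_add polar_simps power2_eq_square algebra_simps)

text \<open>Expanding both conjugates (\<open>star\<close>) and applying \<open>square\<close> gives
  \<open>(trace x)\<^sup>2 - n x\<close> as the coefficient of \<open>e\<close> in the square of
  \<open>x\<close>.\<close>

lemma twisted_TypeIV:
  assumes "2 \<le> dim UNIV"
  shows "twisted_hurwitz_algebra scale mult n e (\<lambda>x y. x\<^bsup>c\<^esup> \<cdot> y\<^bsup>c\<^esup>) (\<lambda>x. (trace x)\<^sup>2 - n x)"
proof (intro twisted_hurwitz_algebra.intro twisted_hurwitz_algebra_axioms.intro)
  fix x y u :: 'a
  have star: "x\<^bsup>c\<^esup> \<cdot> y\<^bsup>c\<^esup> = (trace x * trace y) *\<^sub>s e - trace x *\<^sub>s y - trace y *\<^sub>s x + x \<cdot> y" for x y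
    by (simp add: conj_eq mult_simps scale_right_diff_distrib mult.commute)
  show "x \<cdot> y \<in> span {e, x, y, x\<^bsup>c\<^esup> \<cdot> y\<^bsup>c\<^esup>}"
  proof -
    have "x \<cdot> y = x\<^bsup>c\<^esup> \<cdot> y\<^bsup>c\<^esup> - (trace x * trace y) *\<^sub>s e + trace x *\<^sub>s y + trace y *\<^sub>s x"
      by (simp add: star)
    then show ?thesis by (simp only:) (intro span_add span_diff span_scale; simp add: span_base)
  qed
  show "\<not> is_unity (\<lambda>x y. x\<^bsup>c\<^esup> \<cdot> y\<^bsup>c\<^esup>) u"
  proof
    assume u: "is_unity (\<lambda>x y. x\<^bsup>c\<^esup> \<cdot> y\<^bsup>c\<^esup>) u"
    then have "e\<^bsup>c\<^esup> \<cdot> u\<^bsup>c\<^esup> = e" unfolding is_unity_def by blast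
    then have "u\<^bsup>c\<^esup> = e" by simp
    then have "x\<^bsup>c\<^esup> = x" for x using u by (simp add: is_unity_def)
    then show False using conj_not_identity[OF assms] by blast
  qed
  show "x\<^bsup>c\<^esup> \<cdot> x\<^bsup>c\<^esup> - ((trace x)\<^sup>2 - n x) *\<^sub>s e \<in> span {x}"
  proof -
    have "x\<^bsup>c\<^esup> \<cdot> x\<^bsup>c\<^esup> - ((trace x)\<^sup>2 - n x) *\<^sub>s e = (- trace x) *\<^sub>s x"
      unfolding star[of x x] square[of x] by (simp add: power2_eq_square scale_left_diff_distrib)
    then show ?thesis by (simp only:) (intro span_scale span_base; simp)
  qed
  show "x\<^bsup>c\<^esup> \<cdot> y\<^bsup>c\<^esup> + y\<^bsup>c\<^esup> \<cdot> x\<^bsup>c\<^esup> - polar (\<lambda>x. (trace x)\<^sup>2 - n x) x y *\<^sub>s e \<in> span {x, y}"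
  proof -
    have "x\<^bsup>c\<^esup> \<cdot> y\<^bsup>c\<^esup> + y\<^bsup>c\<^esup> \<cdot> x\<^bsup>c\<^esup> - polar (\<lambda>x. (trace x)\<^sup>2 - n x) x y *\<^sub>s e =
        (- trace y) *\<^sub>s x + (- trace x) *\<^sub>s y"
      using anticommutator[of y x] scale_left_distrib[of "trace x * trace y" "trace x * trace y" e]
      by (simp add: star polar_trace_norm algebra_simps)
    then show ?thesis by (simp only:) (intro span_add span_scale span_base; simp)
  qed
  show "Vector_Spaces.linear scale (*) (polar (\<lambda>x. (trace x)\<^sup>2 - n x) x)"
    using linear_polar[of x]
    by (simp add: Vector_Spaces.linear_iff polar_trace_norm polar_simps algebra_simps)
  show "x \<in> span {e}" if "\<And>y. polar (\<lambda>x. (trace x)\<^sup>2 - n x) x y = 0"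
  proof -
    have "\<langle>(2 * trace x) *\<^sub>s e,y\<rangle> = \<langle>x,y\<rangle>" for y
      using that[of y] by (simp add: polar_trace_norm polar_simps polar_commute[of e])
    then have "x = (2 * trace x) *\<^sub>s e" by (intro polar_eqI) simp
    then show ?thesis unfolding span_singleton by blast
  qed
  assume Q: "(trace x)\<^sup>2 - n x = 0" "polar (\<lambda>x. (trace x)\<^sup>2 - n x) x y = 0"
  \<comment> \<open>The vanishing conditions read \<open>n x = (trace x)\<^sup>2\<close> and
    \<open>\<langle>x,y\<rangle> = 2 * trace x * trace y\<close>. They make the multiples of
    \<open>e\<close> combine with the conjugate of \<open>x\<close> into a multiple of
    \<open>x\<close>.\<close>
  have "x\<^bsup>c\<^esup> \<cdot> (x\<^bsup>c\<^esup> \<cdot> y\<^bsup>c\<^esup>)\<^bsup>c\<^esup> =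
      (trace x * trace y) *\<^sub>s x + (- n x) *\<^sub>s y + (- trace x) *\<^sub>s (x\<^bsup>c\<^esup> \<cdot> y\<^bsup>c\<^esup>)"
  proof -
    have "(x\<^bsup>c\<^esup> \<cdot> y\<^bsup>c\<^esup>)\<^bsup>c\<^esup> = y \<cdot> x" by (simp add: conj_mult)
    also have "\<dots> = trace x *\<^sub>s y + trace y *\<^sub>s x - (2 * trace x * trace y) *\<^sub>s e - x \<cdot> y"
      using anticommutator[of y x] Q(2) by (simp add: polar_trace_norm)
    finally have 1: "x\<^bsup>c\<^esup> \<cdot> (x\<^bsup>c\<^esup> \<cdot> y\<^bsup>c\<^esup>)\<^bsup>c\<^esup> = trace x *\<^sub>s (x\<^bsup>c\<^esup> \<cdot> y) +
        (trace y * n x) *\<^sub>s e - (2 * trace x * trace y) *\<^sub>s x\<^bsup>c\<^esup> - n x *\<^sub>s y"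
      by (simp add: mult_simps conj_mult_cancel_left mult_conj_self)
    have 2: "n x = trace x * trace x" using Q(1) by (simp add: power2_eq_square)
    have 3: "x\<^bsup>c\<^esup> \<cdot> y = trace y *\<^sub>s x\<^bsup>c\<^esup> - x\<^bsup>c\<^esup> \<cdot> y\<^bsup>c\<^esup>"
      by (simp add: conj_eq[of y] mult_simps)
    have 4: "(trace x * trace y) *\<^sub>s x =
        (trace x * trace y * trace x) *\<^sub>s e - (trace x * trace y) *\<^sub>s x\<^bsup>c\<^esup>"
      by (simp add: conj_eq[of x] scale_right_diff_distrib)
    have 5: "(2 * trace x * trace y) *\<^sub>s x\<^bsup>c\<^esup> =
        (trace x * trace y) *\<^sub>s x\<^bsup>c\<^esup> + (trace x * trace y) *\<^sub>s x\<^bsup>c\<^esup>"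
      by (simp flip: scale_left_distrib)
    show ?thesis unfolding 1 2 3 4 5 by (simp add: algebra_simps)
  qed
  then show "x\<^bsup>c\<^esup> \<cdot> (x\<^bsup>c\<^esup> \<cdot> y\<^bsup>c\<^esup>)\<^bsup>c\<^esup> \<in> span {x, y, x\<^bsup>c\<^esup> \<cdot> y\<^bsup>c\<^esup>}" using span_three by metis
  have "(x\<^bsup>c\<^esup> \<cdot> y\<^bsup>c\<^esup>)\<^bsup>c\<^esup> \<cdot> x\<^bsup>c\<^esup> = n x *\<^sub>s y" by (simp add: conj_mult conj_mult_cancel_right)
  then show "(x\<^bsup>c\<^esup> \<cdot> y\<^bsup>c\<^esup>)\<^bsup>c\<^esup> \<cdot> x\<^bsup>c\<^esup> \<in> span {x, y, x\<^bsup>c\<^esup> \<cdot> y\<^bsup>c\<^esup>}" by (simp add: span_scale span_base)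
qed (rule assms hurwitz_algebra_axioms nonassoc_algebra_conj conj_mult_in_filt
    | assumption)+

text \<open>Replaces the isomorphism by one element, the preimage of \<open>(0, 1)\<close>, on which
  trace and norm can be evaluated.\<close>

lemma isomorphic_K_iff:
  "algebra_isomorphic scale mult K_scale (K_mult \<mu>) \<longleftrightarrow>
     (\<exists>a. a \<notin> span {e} \<and> span {e, a} = UNIV \<and> a \<cdot> a = a + \<mu> *\<^sub>s e)"
proof
  assume "algebra_isomorphic scale mult K_scale (K_mult \<mu>)"
  then obtain f where lin: "Vector_Spaces.linear scale K_scale f" and "bij f"
    and f_mult: "\<And>x y. f (x \<cdot> y) = K_mult \<mu> (f x) (f y)"
    unfolding algebra_isomorphic_def by blast
  then have inj: "\<And>x y. f x = f y \<Longrightarrow> x = y" and surj: "\<And>y. \<exists>x. f x = y"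
    by (auto simp: bij_def inj_def surj_def) metis
  have f_lin: "f (x + y) = f x + f y" "f (c *\<^sub>s x) = K_scale c (f x)" for x y c
    using lin by (simp_all add: Vector_Spaces.linear_iff)
  obtain u a where u: "f u = (1, 0)" and a: "f a = (0, 1)" using surj by metis
  have "f (u \<cdot> x) = f x" for x by (simp add: f_mult u K_mult_def)
  then have "u \<cdot> e = e" using inj by blast
  then have e: "f e = (1, 0)" using u by simp
  have comb: "f (p *\<^sub>s e + q *\<^sub>s a) = (p, q)" for p q
    by (simp add: f_lin e a K_scale_def)
  have "a \<notin> span {e}"
  proof
    assume "a \<in> span {e}"
    then obtain r where "a = r *\<^sub>s e" by (auto simp: span_singleton)
    then show False using a by (simp add: f_lin e K_scale_def)
  qed
  moreover have "x \<in> span {e, a}" for x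
  proof -
    have "x = fst (f x) *\<^sub>s e + snd (f x) *\<^sub>s a" by (rule inj) (simp add: comb)
    also have "\<dots> \<in> span {e, a}" by (intro span_add span_scale span_base) simp_all
    finally show ?thesis .
  qed
  then have "span {e, a} = UNIV" by blast
  moreover have "a \<cdot> a = a + \<mu> *\<^sub>s e"
    by (rule inj) (simp add: f_mult f_lin a e K_mult_def K_scale_def)
  ultimately show "\<exists>a. a \<notin> span {e} \<and> span {e, a} = UNIV \<and> a \<cdot> a = a + \<mu> *\<^sub>s e" by blast
next
  assume "\<exists>a. a \<notin> span {e} \<and> span {e, a} = UNIV \<and> a \<cdot> a = a + \<mu> *\<^sub>s e"
  then obtain a where a: "a \<notin> span {e}" "span {e, a} = UNIV" "a \<cdot> a = a + \<mu> *\<^sub>s e" by blast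
  define g where "g x = fst x *\<^sub>s e + snd x *\<^sub>s a" for x
  have zero: "p = 0 \<and> q = 0" if "p *\<^sub>s e + q *\<^sub>s a = 0" for p q
  proof -
    have "q = 0"
    proof (rule ccontr)
      assume "q \<noteq> 0"
      then have "a = inverse q *\<^sub>s (q *\<^sub>s a)" by simp
      also have "q *\<^sub>s a = (- p) *\<^sub>s e" using that by (simp add: add_eq_0_iff)
      also have "inverse q *\<^sub>s (- p) *\<^sub>s e \<in> span {e}" by (intro span_scale span_base) simp
      finally show False using a(1) by contradiction
    qed
    then show ?thesis using that unity_nonzero by simp
  qed
  have inj: "x = y" if "g x = g y" for x y
  proof -
    have "(fst x - fst y) *\<^sub>s e + (snd x - snd y) *\<^sub>s a = g x - g y"
      by (simp add: g_def scale_left_diff_distrib)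
    also have "\<dots> = 0" using that by simp
    finally show ?thesis using zero[of "fst x - fst y" "snd x - snd y"] by (simp add: prod_eq_iff)
  qed
  have surj: "\<exists>y. x = g y" for x
  proof -
    have "x \<in> span {e, a}" using a(2) by simp
    then obtain p q where "x - p *\<^sub>s e = q *\<^sub>s a" by (auto simp: span_insert span_singleton)
    then have "x = g (p, q)" by (simp add: g_def diff_eq_eq add.commute)
    then show ?thesis by blast
  qed
  have "inj g" "surj g" using inj surj by (auto simp: inj_def surj_def)
  then have bij: "bij (inv g)" by (intro bij_imp_bij_inv bijI)
  have gi: "g (inv g x) = x" for x using \<open>surj g\<close> by (rule surj_f_inv_f)
  have g: "g (x + y) = g x + g y" "g (K_scale c x) = c *\<^sub>s g x" "g (K_mult \<mu> x y) = g x \<cdot> g y" for x y c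
    by (simp_all add: g_def K_scale_def K_mult_def mult_simps a(3) algebra_simps)
  have "Vector_Spaces.linear scale K_scale (inv g)"
    unfolding Vector_Spaces.linear_iff
    by (intro conjI allI vector_space_axioms K_vector_space inj) (simp_all add: gi g)
  moreover have "inv g (x \<cdot> y) = K_mult \<mu> (inv g x) (inv g y)" for x y
    by (rule inj) (simp add: gi g)
  ultimately show "algebra_isomorphic scale mult K_scale (K_mult \<mu>)"
    unfolding algebra_isomorphic_def using bij by blast
qed

lemma basis_dim_2:
  assumes "dim UNIV = 2"
  shows "\<exists>a. a \<notin> span {e} \<and> span {e, a} = UNIV"
proof -
  obtain B where B: "{e} \<subseteq> B" "independent B" "UNIV \<subseteq> span B"
    using maximal_independent_subset_extend[of "{e}" UNIV] unity_nonzero by auto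
  then have "card B = 2" using basis_card_eq_dim[of B UNIV] assms by simp
  then obtain a where a: "B = {e, a}" "a \<noteq> e" using B(1) by (auto simp: card_2_iff)
  then have "a \<notin> span {e}" using B(2) by (auto simp: dependent_def insert_Diff_if)
  then show ?thesis using B(3) a by blast
qed

lemma outside_span_unit:
  assumes "span {e, a} = UNIV" "x \<notin> span {e}"
  shows "\<exists>p q. q \<noteq> 0 \<and> x = p *\<^sub>s e + q *\<^sub>s a"
proof -
  have "x \<in> span {e, a}" using assms(1) by simp
  then obtain p q where "x - p *\<^sub>s e = q *\<^sub>s a" by (auto simp: span_insert span_singleton)
  then have x: "x = p *\<^sub>s e + q *\<^sub>s a" by (simp add: diff_eq_eq add.commute)
  moreover have "q \<noteq> 0" using assms(2) x by (auto simp: span_singleton)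
  ultimately show ?thesis by blast
qed

lemma shift_notin: "a \<notin> span {e} \<Longrightarrow> a + r *\<^sub>s e \<notin> span {e}"
  using span_add_eq2[of "r *\<^sub>s e" "{e}" a] by (simp add: span_scale span_base)

text \<open>Compare the given equation with \<open>square\<close>: \<open>a\<close> and
  \<open>e\<close> are independent, so the multiplication alone determines trace and norm.\<close>

lemma trace_norm_of_square:
  assumes "a \<notin> span {e}" "a \<cdot> a = a + \<mu> *\<^sub>s e"
  shows "trace a = 1" "n a = - \<mu>"
proof -
  have eq: "(trace a - 1) *\<^sub>s a = (n a + \<mu>) *\<^sub>s e"
    using square[of a] assms(2) by (simp add: algebra_simps)
  show t: "trace a = 1"
  proof (rule ccontr)
    assume "trace a \<noteq> 1"
    then have "a = inverse (trace a - 1) *\<^sub>s ((trace a - 1) *\<^sub>s a)" by simp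
    also have "\<dots> \<in> span {e}" unfolding eq by (intro span_scale span_base) simp
    finally show False using assms(1) by contradiction
  qed
  then have "n a + \<mu> = 0" using eq unity_nonzero by simp
  then show "n a = - \<mu>" by (simp add: add_eq_0_iff)
qed

lemma norm_shift: "n (a + r *\<^sub>s e) = n a + r * trace a + r\<^sup>2"
  and trace_shift: "trace (a + r *\<^sub>s e) = trace a + 2 * r"
  by (simp_all add: norm_add n_scale polar_simps trace_unit)

end

section \<open>The exceptional planes over the field with two elements\<close>

lemma card_eq_2_iff: "CARD('f::field) = 2 \<longleftrightarrow> (\<forall>c::'f. c = 0 \<or> c = 1)"
proof
  assume card: "CARD('f) = 2"
  then have fin: "finite (UNIV :: 'f set)" by (metis card.infinite zero_neq_numeral)
  have "card {0, 1 :: 'f} = 2" by simp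
  then have "{0, 1 :: 'f} = UNIV" using card by (intro card_subset_eq[OF fin]) simp_all
  then show "\<forall>c::'f. c = 0 \<or> c = 1" by blast
next
  assume "\<forall>c::'f. c = 0 \<or> c = 1"
  then have "(UNIV :: 'f set) = {0, 1}" by auto
  then have "CARD('f) = card {0, 1 :: 'f}" by (rule arg_cong)
  then show "CARD('f) = 2" by simp
qed

context hurwitz_algebra
begin

lemma two_eq_zero:
  assumes "CARD('f) = 2"
  shows "(2 :: 'f) = 0" "(- 1 :: 'f) = 1"
proof -
  have "(2 :: 'f) \<noteq> 1"
  proof
    assume "(2 :: 'f) = 1"
    then have "(1 :: 'f) + 1 = 1 + 0" by simp
    then show False by (simp only: add_left_cancel) simp
  qed
  then show "(2 :: 'f) = 0" using assms unfolding card_eq_2_iff by blast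
  then have "(1 :: 'f) + 1 = 0" by simp
  then show "(- 1 :: 'f) = 1" by (rule minus_unique)
qed

text \<open>All \<open>a + r *\<^sub>s e\<close> lie off the line of \<open>e\<close>, so
  \<open>n a + r * trace a + r\<^sup>2\<close> vanishes for every \<open>r\<close>. The values at 0
  and 1 give \<open>n a = 0\<close> and \<open>trace a = - 1\<close>, and then every
  \<open>r\<close> is a root of \<open>r * (r - 1)\<close>. The algebra is the direct product of two
  copies of the two-element field.\<close>

lemma norm_vanishes_iff:
  assumes "dim UNIV = 2"
  shows "(\<forall>x. x \<notin> span {e} \<longrightarrow> n x = 0) \<longleftrightarrow>
    CARD('f) = 2 \<and> algebra_isomorphic scale mult K_scale (K_mult 0)"
proof
  assume *: "\<forall>x. x \<notin> span {e} \<longrightarrow> n x = 0"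
  obtain a where a: "a \<notin> span {e}" "span {e, a} = UNIV" using basis_dim_2[OF assms] by blast
  have c: "n a + r * trace a + r\<^sup>2 = 0" for r
    using *[rule_format, OF shift_notin[OF a(1), of r]] by (simp only: norm_shift)
  have na: "n a = 0" using c[of 0] by simp
  have ta: "trace a = - 1" using c[of 1] na by (simp add: eq_neg_iff_add_eq_0)
  have "r = 0 \<or> r = 1" for r :: 'f
  proof -
    have "r * (r - 1) = 0" using c[of r] na ta by (simp add: power2_eq_square algebra_simps)
    then show ?thesis by simp
  qed
  then have card: "CARD('f) = 2" by (simp add: card_eq_2_iff)
  have "a \<cdot> a = (- 1) *\<^sub>s a" using square[of a] na ta by simp
  then have "a \<cdot> a = a + 0 *\<^sub>s e" unfolding two_eq_zero(2)[OF card] by simp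
  then show "CARD('f) = 2 \<and> algebra_isomorphic scale mult K_scale (K_mult 0)"
    using card a by (auto simp: isomorphic_K_iff)
next
  assume *: "CARD('f) = 2 \<and> algebra_isomorphic scale mult K_scale (K_mult 0)"
  then obtain a where a: "a \<notin> span {e}" "span {e, a} = UNIV" "a \<cdot> a = a + 0 *\<^sub>s e"
    unfolding isomorphic_K_iff by blast
  have two: "(2 :: 'f) = 0" and F: "c = 0 \<or> c = 1" for c :: 'f
    using * two_eq_zero(1) card_eq_2_iff by blast+
  show "\<forall>x. x \<notin> span {e} \<longrightarrow> n x = 0"
  proof (intro allI impI)
    fix x assume "x \<notin> span {e}"
    then obtain p q where x: "q \<noteq> 0" "x = p *\<^sub>s e + q *\<^sub>s a" using outside_span_unit[OF a(2)] by blast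
    then have "x = a + p *\<^sub>s e" using F[of q] by (simp add: add.commute)
    then show "n x = 0"
      using trace_norm_of_square[OF a(1,3)] F[of p] two by (auto simp: norm_shift)
  qed
qed

text \<open>The same shifts now give \<open>3 * (r * (trace a + r)) = 0\<close> for every
  \<open>r\<close>, so the argument works once 3 is invertible. The resulting algebra is the field
  with four elements.\<close>

lemma trace_norm_vanishes_iff:
  assumes "dim UNIV = 2"
  shows "(\<forall>x. x \<notin> span {e} \<longrightarrow> (trace x)\<^sup>2 - n x = 0) \<longleftrightarrow>
    CARD('f) = 2 \<and> algebra_isomorphic scale mult K_scale (K_mult 1)"
proof
  assume *: "\<forall>x. x \<notin> span {e} \<longrightarrow> (trace x)\<^sup>2 - n x = 0"
  obtain a where a: "a \<notin> span {e}" "span {e, a} = UNIV" using basis_dim_2[OF assms] by blast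
  have na: "n a = (trace a)\<^sup>2" using * a(1) by simp
  have c: "3 * (r * (trace a + r)) = 0" for r
  proof -
    have "(trace a + 2 * r)\<^sup>2 - (n a + r * trace a + r\<^sup>2) = 0"
      using *[rule_format, OF shift_notin[OF a(1), of r]] by (simp only: norm_shift trace_shift)
    then show ?thesis by (simp add: na power2_eq_square algebra_simps)
  qed
  have "(3 :: 'f) \<noteq> 0"
  proof
    assume 3: "(3 :: 'f) = 0"
    have two: "(2 :: 'f) \<noteq> 0"
    proof
      assume 2: "(2 :: 'f) = 0"
      have "(1 :: 'f) = 3 - 2" by simp
      then show False unfolding 2 3 by simp
    qed
    \<comment> \<open>The multiple of \<open>a\<close> shifted to trace 0. Since
      \<open>n a = (trace a)\<^sup>2\<close>, its product with \<open>a\<close> is a multiple of 3,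
      so in characteristic 3 it would lie in the radical of the norm form.\<close>
    let ?w = "2 *\<^sub>s a - trace a *\<^sub>s e"
    have "\<langle>?w,e\<rangle> = 0" by (simp add: polar_simps trace_unit)
    moreover have "\<langle>?w,a\<rangle> = 3 * (trace a)\<^sup>2"
      by (simp add: polar_simps polar_self na polar_commute[of e a] power2_eq_square algebra_simps)
    ultimately have "\<langle>?w,x\<rangle> = 0" if "x \<in> {e, a}" for x using that 3 by auto
    then have "\<langle>?w,y\<rangle> = 0" for y using orthogonal_span[of "{e, a}" ?w y] a(2) by blast
    then have "?w = 0" by (rule polar_nondegenerate)
    then have "inverse 2 *\<^sub>s (2 *\<^sub>s a) = inverse 2 *\<^sub>s (trace a *\<^sub>s e)" by simp
    then have "a = (inverse 2 * trace a) *\<^sub>s e" using two by simp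
    then show False using a(1) unfolding span_singleton by blast
  qed
  then have c': "r = 0 \<or> trace a + r = 0" for r using c[of r] by simp
  have ta: "trace a = - 1" using c'[of 1] by (simp add: eq_neg_iff_add_eq_0)
  have "r = 0 \<or> r = 1" for r :: 'f using c'[of r] by (simp add: ta)
  then have card: "CARD('f) = 2" by (simp add: card_eq_2_iff)
  have "a \<cdot> a = (- 1) *\<^sub>s a + (- 1) *\<^sub>s e" using square[of a] na ta by simp
  then have "a \<cdot> a = a + 1 *\<^sub>s e" unfolding two_eq_zero(2)[OF card] by simp
  then show "CARD('f) = 2 \<and> algebra_isomorphic scale mult K_scale (K_mult 1)"
    unfolding isomorphic_K_iff using card a by blast
next
  assume *: "CARD('f) = 2 \<and> algebra_isomorphic scale mult K_scale (K_mult 1)"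
  then obtain a where a: "a \<notin> span {e}" "span {e, a} = UNIV" "a \<cdot> a = a + 1 *\<^sub>s e"
    unfolding isomorphic_K_iff by blast
  have two: "(2 :: 'f) = 0" and F: "c = 0 \<or> c = 1" for c :: 'f
    using * two_eq_zero(1) card_eq_2_iff by blast+
  show "\<forall>x. x \<notin> span {e} \<longrightarrow> (trace x)\<^sup>2 - n x = 0"
  proof (intro allI impI)
    fix x assume "x \<notin> span {e}"
    then obtain p q where x: "q \<noteq> 0" "x = p *\<^sub>s e + q *\<^sub>s a" using outside_span_unit[OF a(2)] by blast
    then have x: "x = a + p *\<^sub>s e" using F[of q] by (simp add: add.commute)
    have "trace x = 1" using two by (simp add: x trace_shift trace_norm_of_square[OF a(1,3)])
    moreover have "n x = 1"
    proof -
      have "n x = - 1 + (p + p\<^sup>2)" by (simp add: x norm_shift trace_norm_of_square[OF a(1,3)])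
      also have "p + p\<^sup>2 = 0" using F[of p] two by auto
      finally show ?thesis using two_eq_zero(2) * by simp
    qed
    ultimately show "(trace x)\<^sup>2 - n x = 0" by simp
  qed
qed

lemma dim_of_isomorphic_K:
  assumes "algebra_isomorphic scale mult K_scale (K_mult \<mu>)"
  shows "dim UNIV \<le> 2"
proof -
  obtain a where "span {e, a} = UNIV" using assms unfolding isomorphic_K_iff by blast
  then have "dim UNIV \<le> card {e, a}" by (intro dim_le_card) auto
  also have "\<dots> \<le> 2" by (simp add: card_insert_if)
  finally show ?thesis .
qed

text \<open>The maximum with 2 matters only in dimension 2, where the logarithm is 1;
  \<open>C\<close> is the condition under which even the length drops to 1.\<close>

lemma alg_length_twisted:
  assumes tw: "twisted_hurwitz_algebra scale mult n e star Q" and dim: "2 \<le> dim UNIV"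
    and exceptional: "C \<Longrightarrow> dim UNIV \<le> 2"
    and Q: "dim UNIV = 2 \<Longrightarrow> (\<forall>x. x \<notin> span {e} \<longrightarrow> Q x = 0) \<longleftrightarrow> C"
  shows "(C \<longrightarrow> alg_length scale star = 1) \<and>
    (\<not> C \<longrightarrow> real (alg_length scale star) = max 2 (log 2 (real (dim UNIV))))"
proof -
  interpret tw: twisted_hurwitz_algebra scale mult n e star Q by (rule tw)
  obtain as :: "'a list" where as: "dim UNIV = 2 ^ length as" using hurwitz by blast
  show ?thesis
  proof (cases "dim UNIV = 2")
    case True
    then show ?thesis using tw.alg_length_star_dim_2[OF True] Q[OF True] by auto
  next
    case False
    then have "\<not> C" using exceptional dim by auto
    have "2 \<le> length as"
    proof (rule ccontr)
      assume "\<not> 2 \<le> length as"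
      then have "length as = 0 \<or> length as = 1" by linarith
      then show False using False dim as by auto
    qed
    then have "alg_length scale star = length as" by (rule tw.alg_length_star_ge_2[OF as])
    moreover have "log 2 (real (dim UNIV)) = length as" by (simp add: as)
    ultimately show ?thesis using \<open>\<not> C\<close> \<open>2 \<le> length as\<close> by simp
  qed
qed

lemma alg_length_TypeII:
  assumes "2 \<le> dim UNIV"
    and C: "C \<longleftrightarrow> CARD('f) = 2 \<and> algebra_isomorphic scale mult K_scale (K_mult 0)"
    and l: "l = alg_length scale (standard_mult TypeII scale mult n e)"
  shows "(C \<longrightarrow> l = 1) \<and> (\<not> C \<longrightarrow> real l = max 2 (log 2 (real (dim UNIV))))"
proof -
  have star: "standard_mult TypeII scale mult n e = (\<lambda>x y. x\<^bsup>c\<^esup> \<cdot> y)" by (intro ext) simp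
  show ?thesis unfolding l star C
    by (rule alg_length_twisted[OF twisted_TypeII[OF assms(1)] assms(1) _ norm_vanishes_iff])
      (elim conjE dim_of_isomorphic_K)
qed

lemma alg_length_TypeIV:
  assumes "2 \<le> dim UNIV"
    and C: "C \<longleftrightarrow> CARD('f) = 2 \<and> algebra_isomorphic scale mult K_scale (K_mult 1)"
    and l: "l = alg_length scale (standard_mult TypeIV scale mult n e)"
  shows "(C \<longrightarrow> l = 1) \<and> (\<not> C \<longrightarrow> real l = max 2 (log 2 (real (dim UNIV))))"
proof -
  have star: "standard_mult TypeIV scale mult n e = (\<lambda>x y. x\<^bsup>c\<^esup> \<cdot> y\<^bsup>c\<^esup>)" by (intro ext) simp
  show ?thesis unfolding l star C
    by (rule alg_length_twisted[OF twisted_TypeIV[OF assms(1)] assms(1) _ trace_norm_vanishes_iff])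
      (elim conjE dim_of_isomorphic_K)
qed

lemma alg_length_TypeI:
  "real (alg_length scale (standard_mult TypeI scale mult n e)) = log 2 (real (dim UNIV))"
proof -
  have star: "standard_mult TypeI scale mult n e = (\<cdot>)" by (intro ext) simp
  obtain as :: "'a list" where as: "dim UNIV = 2 ^ length as" using hurwitz by blast
  show ?thesis unfolding star alg_length_mult[OF as] by (simp add: as)
qed

section \<open>Type III through the opposite algebra\<close>

lemma opposite: "hurwitz_algebra scale (\<lambda>x y. y \<cdot> x) n e"
proof (intro hurwitz_algebra.intro composition_algebra.intro nonassoc_algebra.intro
    hurwitz_algebra_axioms.intro composition_algebra_axioms.intro nonassoc_algebra_axioms.intro)
  show "is_unity (\<lambda>x y. y \<cdot> x) e" by (simp add: is_unity_def)
  show "n (y \<cdot> x) = n x * n y" for x y by (simp add: n_mult)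
  show "x = 0" if "\<And>y. \<langle>x,y\<rangle> = 0" for x using that by (rule polar_nondegenerate)
qed (rule vector_space_axioms linear_mult_left linear_mult_right n_scale linear_polar_left
    linear_polar_right unity_nonzero)+

text \<open>The exceptional condition does not see the reversal because \<open>K_mult\<close> is
  commutative.\<close>

lemma opposite_isomorphic_K:
  "algebra_isomorphic scale (\<lambda>x y. y \<cdot> x) K_scale (K_mult \<mu>) \<longleftrightarrow>
    algebra_isomorphic scale mult K_scale (K_mult \<mu>)"
proof -
  have comm: "K_mult \<mu> x y = K_mult \<mu> y x" for x y by (simp add: K_mult_def algebra_simps)
  have "(\<forall>x y. f (y \<cdot> x) = K_mult \<mu> (f x) (f y)) \<longleftrightarrow> (\<forall>x y. f (x \<cdot> y) = K_mult \<mu> (f x) (f y))" for f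
  proof (intro iffI allI)
    fix x y
    show "f (x \<cdot> y) = K_mult \<mu> (f x) (f y)" if "\<forall>x y. f (y \<cdot> x) = K_mult \<mu> (f x) (f y)"
      using that[rule_format, where x = y and y = x] comm[of "f x" "f y"] by (rule trans[OF _ sym])
    show "f (y \<cdot> x) = K_mult \<mu> (f x) (f y)" if "\<forall>x y. f (x \<cdot> y) = K_mult \<mu> (f x) (f y)"
      using that[rule_format, where x = y and y = x] comm[of "f x" "f y"] by (rule trans[OF _ sym])
  qed
  then show ?thesis unfolding algebra_isomorphic_def by (simp only:)
qed

end

lemma word_opposite: "word (\<lambda>x y. f y x) S i x \<longleftrightarrow> word f S i x"
proof -
  have *: "word (\<lambda>x y. f y x) S i x" if "word f S i x" for f :: "'a \<Rightarrow> 'a \<Rightarrow> 'a" and i x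
    using that
  proof (induction rule: word.induct)
    case (word_unity u)
    then show ?case by (intro word.word_unity) (auto simp: is_unity_def)
  next
    case (word_gen a)
    then show ?case by (rule word.word_gen)
  next
    case (word_mult i a j b)
    then show ?case using word.word_mult[of "\<lambda>x y. f y x" S j b i a] by (simp add: add.commute)
  qed
  show ?thesis by (rule iffI[OF *[of "\<lambda>x y. f y x"] *[of f]])
qed

lemma alg_length_opposite: "alg_length scale (\<lambda>x y. f y x) = alg_length scale f"
  unfolding alg_length_def set_length_def generating_def L_infty_def L_upto_def word_opposite[of f] ..

theorem theorem3p8:
  fixes scale :: "'f::field \<Rightarrow> 'a::ab_group_add \<Rightarrow> 'a"
    and mult :: "'a \<Rightarrow> 'a \<Rightarrow> 'a" and n :: "'a \<Rightarrow> 'f" and e :: 'a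
    and T :: standard_type
  assumes "hurwitz_algebra scale mult n e"
    and "T \<in> {TypeII, TypeIII, TypeIV} \<Longrightarrow> 2 \<le> vector_space.dim scale (UNIV :: 'a set)"
  shows
    "let l = alg_length scale (standard_mult T scale mult n e);
         d = vector_space.dim scale (UNIV :: 'a set);
         case1 = (T = TypeI);
         case2 = (CARD('f) = 2 \<and> algebra_isomorphic scale mult K_scale (K_mult (0 :: 'f))
                    \<and> T \<in> {TypeII, TypeIII});
         case3 = (CARD('f) = 2 \<and> algebra_isomorphic scale mult K_scale (K_mult (1 :: 'f))
                    \<and> T = TypeIV)
     in (case1 \<longrightarrow> real l = log 2 (real d)) \<and>
        (case2 \<longrightarrow> l = 1) \<and>
        (case3 \<longrightarrow> l = 1) \<and>
        (\<not> case1 \<and> \<not> case2 \<and> \<not> case3 \<longrightarrow> real l = max 2 (log 2 (real d)))"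
proof -
  interpret hurwitz_algebra scale mult n e by (rule assms(1))
  show ?thesis
  proof (cases T)
    case TypeI
    then show ?thesis using alg_length_TypeI by (simp add: Let_def)
  next
    case TypeII
    then show ?thesis
      using alg_length_TypeII[OF _ refl refl] assms(2) by (simp add: Let_def)
  next
    case TypeIII
    \<comment> \<open>The involution depends only on \<open>n\<close> and \<open>e\<close>, which
      the opposite algebra shares, so reversing both the product and the arguments turns type II
      into type III.\<close>
    have eq: "standard_mult TypeIII scale mult n e =
        (\<lambda>x y. standard_mult TypeII scale (\<lambda>x y. mult y x) n e y x)"
      by (intro ext) simp
    have "alg_length scale (standard_mult TypeIII scale mult n e) =
        alg_length scale (standard_mult TypeII scale (\<lambda>x y. mult y x) n e)"
      unfolding eq by (rule alg_length_opposite)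
    from hurwitz_algebra.alg_length_TypeII[OF opposite _ refl this] show ?thesis
      using assms(2) TypeIII by (simp add: Let_def opposite_isomorphic_K)
  next
    case TypeIV
    then show ?thesis
      using alg_length_TypeIV[OF _ refl refl] assms(2) by (simp add: Let_def)
  qed
qed

end
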